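(* Let $k$ be an infinite perfect field, let $R=k[x_1,x_2]$ be a standard graded polynomial ring, and let $I$ be a height two ideal of $R$ minimally generated by homogeneous forms $g_1,\dots,g_n$ of the same degree $d$. Let $A=k[I_d]$, let $\Psi:\mathbb P^1_k\to\mathbb P^{n-1}_k$ be the morphism $q\mapsto[g_1(q):\dots:g_n(q)]$, and let $\varphi$ be a minimal homogeneous Hilbert-Burch matrix for the row vector $[g_1,\dots,g_n]$. If $q_1$ and $q_2$ are general points in $\mathbb P^1_k$, then $A\subset k[f_1,f_2]$, where $f_i=\gcd(I_1(p_i\varphi))$ with $p_i=\Psi(q_i)$ for $i=1,2$.
   Context: A minimal homogeneous Hilbert-Burch matrix $\varphi$ is an $n\times(n-1)$ matrix with homogeneous entries such that $0\to\bigoplus_{j=1}^{n-1}R(-d-D_j)\xrightarrow{\varphi}R(-d)^n\xrightarrow{[g_1,\dots,g_n]}R$ is a minimal homogeneous resolution of $R/I$ and $g_i$ is, up to a common unit of $k$, $(-1)^i$ times the determinant of $\varphi$ with row $i$ deleted. For a rational point $p=[\alpha_1:\dots:\alpha_n]\in\mathbb P^{n-1}_k$, $p\varphi$ is the product of the row vector $(\alpha_1,\dots,\alpha_n)$ with $\varphi$, and $I_1(p\varphi)$ is the ideal of $R$ generated by its entries (independent of the chosen representative of $p$). For a homogeneous ideal $L$ of $R$, $\gcd(L)$ is the greatest common divisor of a generating set of $L$ (well defined up to a unit of $k$). A property holds for general points if it holds for all ($k$-rational) points in some dense open subset of the parameter space (here, for all pairs $(q_1,q_2)$ in a dense open subset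 of $\mathbb P^1_k\times\mathbb P^1_k$). *)

theory Defs
  imports
    "HOL-Analysis.Abstract_Topology"
    "HOL-Library.Extended_Nat"
    "HOL-Computational_Algebra.Polynomial"
    "Jordan_Normal_Form.Determinant"
    "Jordan_Normal_Form.DL_Submatrix"
begin

definition perfect_field :: "'k::field itself \<Rightarrow> bool" where
  "perfect_field _ \<longleftrightarrow> CHAR('k) = 0 \<or> surj (\<lambda>x::'k. x ^ CHAR('k))"


section \<open>The ring \<open>k[x\<^sub>1,x\<^sub>2]\<close>\<close>

text \<open>
  \<open>R = k[x\<^sub>1,x\<^sub>2]\<close> is \<open>'k poly poly\<close>: the inner variable is \<open>x\<^sub>1\<close>, the outer one is \<open>x\<^sub>2\<close>, so
  \<open>coeff (coeff f j) i\<close> is the coefficient of \<open>x\<^sub>1^i x\<^sub>2^j\<close>.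
\<close>

definition const2 :: "'k::field \<Rightarrow> 'k poly poly" where
  "const2 c = [:[:c:]:]"

definition X1 :: "'k::field poly poly" where
  "X1 = [:[:0, 1:]:]"

definition X2 :: "'k::field poly poly" where
  "X2 = [:0, 1:]"

definition homogeneous :: "nat \<Rightarrow> 'k::field poly poly \<Rightarrow> bool" where
  "homogeneous d f \<longleftrightarrow> (\<forall>i j. coeff (coeff f j) i \<noteq> 0 \<longrightarrow> i + j = d)"

text \<open>The value \<open>f(v\<^sub>1, v\<^sub>2)\<close>; vector entries are indexed from 0.\<close>

definition eval2 :: "'k::field poly poly \<Rightarrow> 'k vec \<Rightarrow> 'k" where
  "eval2 f v = poly (poly f [:v $ 1:]) (v $ 0)"

definition subalgebra :: "'k::field poly poly set \<Rightarrow> bool" where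
  "subalgebra B \<longleftrightarrow> range const2 \<subseteq> B \<and> (\<forall>a\<in>B. \<forall>b\<in>B. a + b \<in> B \<and> a * b \<in> B)"

definition adjoin :: "'k::field poly poly set \<Rightarrow> 'k poly poly set" where
  "adjoin S = subalgebra hull S"


section \<open>Ideals\<close>

abbreviation is_ideal :: "'a::comm_ring_1 set \<Rightarrow> bool" where
  "is_ideal \<equiv> Modules.module.subspace times"

abbreviation ideal_gen :: "'a::comm_ring_1 set \<Rightarrow> 'a set" where
  "ideal_gen \<equiv> Modules.module.span times"

definition prime_ideal :: "'a::comm_ring_1 set \<Rightarrow> bool" where
  "prime_ideal P \<longleftrightarrow>
     is_ideal P \<and> P \<noteq> UNIV \<and> (\<forall>a b. a * b \<in> P \<longrightarrow> a \<in> P \<or> b \<in> P)"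

definition height_prime :: "'a::comm_ring_1 set \<Rightarrow> enat" where
  "height_prime P = Sup {enat r | r. \<exists>C :: nat \<Rightarrow> 'a set.
     (\<forall>i\<le>r. prime_ideal (C i)) \<and> (\<forall>i<r. C i \<subset> C (Suc i)) \<and> C r = P}"

text \<open>The unit ideal gets height \<open>\<infinity>\<close>.\<close>

definition height :: "'a::comm_ring_1 set \<Rightarrow> enat" where
  "height I = Inf {height_prime P | P. prime_ideal P \<and> I \<subseteq> P}"

definition minimally_generates :: "'a::comm_ring_1 vec \<Rightarrow> 'a set \<Rightarrow> bool" where
  "minimally_generates g I \<longleftrightarrow>
     I = ideal_gen (($) g ` {..<dim_vec g}) \<and>
     (\<forall>i<dim_vec g. ideal_gen (($) g ` ({..<dim_vec g} - {i})) \<noteq> I)"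

definition is_gcd :: "'a::comm_ring_1 set \<Rightarrow> 'a \<Rightarrow> bool" where
  "is_gcd S f \<longleftrightarrow> (\<forall>s\<in>S. f dvd s) \<and> (\<forall>h. (\<forall>s\<in>S. h dvd s) \<longrightarrow> h dvd f)"

definition is_gcd_of_ideal :: "'a::comm_ring_1 set \<Rightarrow> 'a \<Rightarrow> bool" where
  "is_gcd_of_ideal L f \<longleftrightarrow> (\<exists>S. ideal_gen S = L \<and> is_gcd S f)"


section \<open>Hilbert-Burch matrices\<close>

text \<open>
  For homogeneous forms \<open>g\<^sub>1, \<dots>, g\<^sub>n\<close> of one degree. The clauses on \<open>\<phi>\<close> say, in order: column \<open>j\<close> is
  homogeneous of degree \<open>D\<^sub>j\<close>; the resolution is minimal (no entry of \<open>\<phi>\<close> lies outside the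
  homogeneous maximal ideal); \<open>\<phi>\<close> is injective; the image of \<open>\<phi>\<close> is the kernel of
  \<open>[g\<^sub>1, \<dots>, g\<^sub>n]\<close>; the \<open>g\<^sub>i\<close> are the signed maximal minors up to a common unit. In the last
  clause \<open>i\<close> is the row index counted from 0, whence the sign \<open>(-1)^(i+1)\<close>.
\<close>

definition minimal_hilbert_burch :: "'k::field poly poly vec \<Rightarrow> 'k poly poly mat \<Rightarrow> bool" where
  "minimal_hilbert_burch g \<phi> \<longleftrightarrow> (let n = dim_vec g in
     \<phi> \<in> carrier_mat n (n - 1) \<and>
     (\<exists>D :: nat \<Rightarrow> nat. \<forall>i<n. \<forall>j<n - 1. homogeneous (D j) (\<phi> $$ (i, j))) \<and>
     (\<forall>i<n. \<forall>j<n - 1. \<phi> $$ (i, j) \<in> ideal_gen {X1, X2}) \<and>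
     (\<forall>w\<in>carrier_vec (n - 1). \<phi> *\<^sub>v w = 0\<^sub>v n \<longrightarrow> w = 0\<^sub>v (n - 1)) \<and>
     {\<phi> *\<^sub>v w | w. w \<in> carrier_vec (n - 1)} = {v \<in> carrier_vec n. g \<bullet> v = 0} \<and>
     (\<exists>u::'k. u \<noteq> 0 \<and> (\<forall>i<n.
        g $ i = const2 u * (- 1) ^ (i + 1) * det (submatrix \<phi> (- {i}) UNIV))))"


section \<open>Projective points\<close>

text \<open>
  A rational point of \<open>\<P>\<^sup>m\<^sup>-\<^sup>1\<close> is the set of its representatives \<open>v \<in> k\<^sup>m - {0}\<close>. Constructions
  that do not depend on the representative are written as a union over all representatives,
  as for quotients in \<^theory>\<open>HOL.Equiv_Relations\<close>.
\<close>

definition proj_point :: "'k::field vec \<Rightarrow> 'k vec set" where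
  "proj_point v = {c \<cdot>\<^sub>v v | c. c \<noteq> 0}"

definition proj_space :: "nat \<Rightarrow> 'k::field vec set set" where
  "proj_space m = proj_point ` (carrier_vec m - {0\<^sub>v m})"

definition proj_map :: "'k::field poly poly vec \<Rightarrow> 'k vec set \<Rightarrow> 'k vec set" where
  "proj_map g q = (\<Union>v\<in>q. proj_point (map_vec (\<lambda>f. eval2 f v) g))"

text \<open>The row vector \<open>v\<phi>\<close> is computed as \<open>\<phi>\<^sup>T v\<close>.\<close>

definition I1_at :: "'k::field vec set \<Rightarrow> 'k poly poly mat \<Rightarrow> 'k poly poly set" where
  "I1_at p \<phi> = (\<Union>v\<in>p. ideal_gen (set\<^sub>v (transpose_mat \<phi> *\<^sub>v map_vec const2 v)))"

lemma module_times: "Modules.module (times :: 'a::comm_ring_1 \<Rightarrow> 'a \<Rightarrow> 'a)"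
  by unfold_locales (auto simp: algebra_simps)

lemma eval2_smult:
  assumes "homogeneous d f" "v \<in> carrier_vec 2"
  shows "eval2 f (c \<cdot>\<^sub>v v) = c ^ d * eval2 f v"
proof -
  have e: "eval2 f w = (\<Sum>j\<le>degree f. \<Sum>i\<le>degree (coeff f j). coeff (coeff f j) i * (w $ 0) ^ i * (w $ 1) ^ j)" for w
    unfolding eval2_def poly_altdef[of f] poly_sum poly_mult poly_power
    by (simp add: poly_altdef[of "coeff f _"] sum_distrib_right)
  have t: "coeff (coeff f j) i * ((c * a) ^ i) * ((c * b) ^ j) = c ^ d * (coeff (coeff f j) i * a ^ i * b ^ j)" for i j a b
  proof (cases "coeff (coeff f j) i = 0")
    case False
    then have "d = i + j" using assms(1) by (simp add: homogeneous_def)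
    then show ?thesis by (simp add: power_mult_distrib power_add)
  qed simp
  show ?thesis using assms(2) by (simp add: e t sum_distrib_left)
qed

lemma proj_map_proj_point:
  assumes "\<forall>i<dim_vec g. homogeneous d (g $ i)" "v \<in> carrier_vec 2"
  shows "proj_map g (proj_point v) = proj_point (map_vec (\<lambda>f. eval2 f v) g)"
proof -
  have m: "map_vec (\<lambda>f. eval2 f (c \<cdot>\<^sub>v v)) g = c ^ d \<cdot>\<^sub>v map_vec (\<lambda>f. eval2 f v) g" for c
    using assms by (intro eq_vecI) (auto simp: eval2_smult)
  have p: "proj_point (c ^ d \<cdot>\<^sub>v w) = proj_point w" if "c \<noteq> 0" for c and w :: "'a vec"
  proof -
    have "c ^ d \<noteq> 0" using that by simp
    then have "\<exists>b'. b = b' * c ^ d \<and> b' \<noteq> 0" if "b \<noteq> 0" for b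
      using that by (intro exI[of _ "b / c ^ d"]) auto
    then show ?thesis using that unfolding proj_point_def
      by (auto simp: smult_smult_assoc)
  qed
  have "proj_map g (proj_point v) = (\<Union>c\<in>-{0}. proj_point (map_vec (\<lambda>f. eval2 f (c \<cdot>\<^sub>v v)) g))"
    by (auto simp: proj_map_def proj_point_def[of v])
  moreover have "(\<Union>c\<in>-{0}. proj_point (map_vec (\<lambda>f. eval2 f (c \<cdot>\<^sub>v v)) g)) = (\<Union>c\<in>-{0::'a}. proj_point (map_vec (\<lambda>f. eval2 f v) g))"
    by (intro SUP_cong) (auto simp: m p)
  moreover have "- {0::'a} \<noteq> {}" by (metis ComplI empty_iff singletonD zero_neq_one)
  ultimately show ?thesis by auto
qed

lemma I1_at_proj_point:
  assumes "v \<in> carrier_vec (dim_row \<phi>)"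
  shows "I1_at (proj_point v) \<phi> = ideal_gen (set\<^sub>v (transpose_mat \<phi> *\<^sub>v map_vec const2 v))"
proof -
  interpret Modules.module "times :: 'a poly poly \<Rightarrow> _" by (rule module_times)
  let ?w = "\<lambda>c. transpose_mat \<phi> *\<^sub>v map_vec const2 (c \<cdot>\<^sub>v v)"
  have s: "set\<^sub>v (a \<cdot>\<^sub>v w) = times a ` set\<^sub>v w" for a and w :: "'a poly poly vec"
    by (auto simp: vec_set_def)
  have w: "?w (a * c) = const2 a \<cdot>\<^sub>v ?w c" for a c
  proof -
    have "map_vec const2 ((a * c) \<cdot>\<^sub>v v) = const2 a \<cdot>\<^sub>v map_vec const2 (c \<cdot>\<^sub>v v)"
      by (rule eq_vecI) (auto simp: const2_def)
    then show ?thesis using assms by (auto intro!: eq_vecI scalar_prod_smult_distrib)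
  qed
  have le: "ideal_gen (set\<^sub>v (?w (a * c))) \<subseteq> ideal_gen (set\<^sub>v (?w c))" for a c
    unfolding w s by (rule span_minimal) (auto intro: span_scale span_base)
  have "ideal_gen (set\<^sub>v (?w c)) = ideal_gen (set\<^sub>v (?w 1))" if "c \<noteq> 0" for c
    using le[of c 1] le[of "1 / c" c] that by auto
  then have "(\<Union>c\<in>-{0}. ideal_gen (set\<^sub>v (?w c))) = (\<Union>c\<in>-{0::'a}. ideal_gen (set\<^sub>v (?w 1)))"
    by (intro SUP_cong) auto
  moreover have "I1_at (proj_point v) \<phi> = (\<Union>c\<in>-{0}. ideal_gen (set\<^sub>v (?w c)))"
    by (auto simp: I1_at_def proj_point_def)
  moreover have "- {0::'a} \<noteq> {}" by (metis ComplI empty_iff singletonD zero_neq_one)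
  ultimately show ?thesis by auto
qed


section \<open>General pairs of points of the projective line\<close>

text \<open>
  The Zariski topology on the rational points of \<open>\<P>\<^sup>1 \<times> \<P>\<^sup>1\<close>, generated by the sets where a form of
  bidegree \<open>(r, s)\<close>, given by its coefficients \<open>c\<close>, does not vanish.
\<close>

definition biform :: "nat \<Rightarrow> nat \<Rightarrow> (nat \<Rightarrow> nat \<Rightarrow> 'k::field) \<Rightarrow> 'k vec \<Rightarrow> 'k vec \<Rightarrow> 'k" where
  "biform r s c u v = (\<Sum>i\<le>r. \<Sum>j\<le>s.
     c i j * ((u $ 0) ^ i * (u $ 1) ^ (r - i)) * ((v $ 0) ^ j * (v $ 1) ^ (s - j)))"

definition nonvanishing ::
    "nat \<Rightarrow> nat \<Rightarrow> (nat \<Rightarrow> nat \<Rightarrow> 'k::field) \<Rightarrow> ('k vec set \<times> 'k vec set) set" where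
  "nonvanishing r s c = {(q\<^sub>1, q\<^sub>2). q\<^sub>1 \<in> proj_space 2 \<and> q\<^sub>2 \<in> proj_space 2 \<and>
     (\<forall>u\<in>q\<^sub>1. \<forall>v\<in>q\<^sub>2. biform r s c u v \<noteq> 0)}"

definition zariski_P1_P1 :: "('k::field vec set \<times> 'k vec set) topology" where
  "zariski_P1_P1 = topology_generated_by {nonvanishing r s c | r s c. True}"

definition for_general_pairs :: "('k::field vec set \<Rightarrow> 'k vec set \<Rightarrow> bool) \<Rightarrow> bool" where
  "for_general_pairs Q \<longleftrightarrow> (\<exists>U.
     openin zariski_P1_P1 U \<and>
     Abstract_Topology.closure_of zariski_P1_P1 U = topspace zariski_P1_P1 \<and>
     (\<forall>(q\<^sub>1, q\<^sub>2)\<in>U. Q q\<^sub>1 q\<^sub>2))"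

end

theory Submission
  imports Defs
begin


text \<open>
  Let \<open>q\<close> be a point of the line and \<open>p = \<Psi>(q)\<close>. Columns of \<open>\<phi>\<close> are syzygies of
  \<open>g\<^sub>1, \<dots>, g\<^sub>n\<close>, and the Koszul syzygies are combinations of columns. The first fact shows that the
  gcd of the differences \<open>g\<^sub>i(x) g\<^sub>j(q) - g\<^sub>j(x) g\<^sub>i(q)\<close> divides every entry of \<open>p\<phi>\<close>, and the
  second that these differences lie in \<open>I\<^sub>1(p\<phi>)\<close>; so \<open>gcd(I\<^sub>1(p\<phi>))\<close> is the form \<open>f\<^sub>q\<close> of the fibre of
  \<open>\<Psi>\<close> through \<open>q\<close> (\<open>gcd_of_fibre_ideal\<close>). Because the height is two, the \<open>g\<^sub>i\<close> have no common
  factor and \<open>\<Psi>\<close> is not constant (\<open>height_two_imp_pencil_conditions\<close>).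

  By Lueroth's theorem \<open>\<Psi>\<close> factors through a map \<open>[a : b]\<close> of the line to itself
  whose fibres are, generically, those of \<open>\<Psi>\<close>. In terms of forms: there are coprime forms \<open>a, b\<close> of
  one degree \<open>r\<close> with \<open>f\<^sub>q = b(q) a - a(q) b\<close>, up to a constant, for general \<open>q\<close>
  (\<open>luroth_pencil\<close>), and every \<open>g\<^sub>i\<close> is a form in \<open>a\<close> and \<open>b\<close> (\<open>forms_in_pencil\<close>). For general \<open>q\<^sub>1, q\<^sub>2\<close>
  the forms \<open>f\<^sub>1, f\<^sub>2\<close> are independent members of the pencil spanned by \<open>a\<close> and \<open>b\<close>, so
  \<open>k[f\<^sub>1, f\<^sub>2] = k[a, b]\<close> contains all \<open>g\<^sub>i\<close>.

  The theorem on \<open>a, b\<close> is proved without field extensions. Dehomogenize by \<open>x\<^sub>2 = 1\<close> and let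
  \<open>F(x, y)\<close> be the gcd of the minors \<open>g\<^sub>i(x) g\<^sub>j(y) - g\<^sub>j(x) g\<^sub>i(y)\<close> over \<open>k(y)\<close>, cleared of denominators and
  of factors in \<open>k[y]\<close>. Points of one fibre have the same fibre: modulo \<open>F(y, q)\<close> the
  polynomials \<open>F(x, y)\<close> and \<open>F(x, q)\<close> in \<open>x\<close> are proportional. Hence the \<open>2 \<times> 2\<close> minors of
  their coefficient vectors are divisible by \<open>F(y, q)\<close>, and a comparison of degrees shows that
  \<open>F(x, y)\<close> is itself such a minor \<open>a(x) b(y) - b(x) a(y)\<close>.
\<close>

section \<open>Ideals in polynomial rings\<close>

lemmas ideal_base = module.span_base[OF module_times]
  and ideal_add = module.span_add[OF module_times]
  and ideal_diff = module.span_diff[OF module_times]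
  and ideal_scale = module.span_scale[OF module_times]
  and ideal_zero = module.span_zero[OF module_times]
  and ideal_sum = module.span_sum[OF module_times]
  and ideal_mono = module.span_mono[OF module_times]
  and ideal_induct = module.span_induct_alt[OF module_times, consumes 1, case_names zero step]
  and is_idealI = module.subspaceI[OF module_times]

lemma dvd_ideal_gen:
  assumes "x \<in> ideal_gen S" "\<And>s. s \<in> S \<Longrightarrow> f dvd s"
  shows "f dvd x"
  using assms(1) by (induction rule: ideal_induct) (auto simp: assms(2))

lemma ideal_gen_pair: "x \<in> ideal_gen {a, b} \<longleftrightarrow> (\<exists>u v. x = u * a + v * b)"
proof
  assume "x \<in> ideal_gen {a, b}"
  then show "\<exists>u v. x = u * a + v * b"
  proof (induction rule: ideal_induct)
    case zero
    then show ?case by (intro exI[of _ 0]) simp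
  next
    case (step c s y)
    then obtain u v where y: "y = u * a + v * b" by blast
    show ?case
    proof (cases "s = a")
      case True
      then show ?thesis by (intro exI[of _ "c + u"] exI[of _ v]) (simp add: y algebra_simps)
    next
      case False
      then have "s = b" using step by simp
      then show ?thesis by (intro exI[of _ u] exI[of _ "c + v"]) (simp add: y algebra_simps)
    qed
  qed
next
  assume "\<exists>u v. x = u * a + v * b"
  moreover have "u * a + v * b \<in> ideal_gen {a, b}" for u v
    by (intro ideal_add ideal_scale ideal_base) auto
  ultimately show "x \<in> ideal_gen {a, b}" by auto
qed

text \<open>
  Over the fraction field of the coefficients the ideal is principal; clearing denominators puts the
  generator into the ideal itself, at the price of a factor \<open>e\<close> in front of \<open>P\<close>.
\<close>

lemma ideal_gen_pseudo_principal:
  fixes S :: "'a::idom poly set"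
  assumes "p \<in> S" "p \<noteq> 0"
  obtains F where "F \<in> ideal_gen S" "F \<noteq> 0"
    "\<And>P. P \<in> ideal_gen S \<Longrightarrow> \<exists>e. e \<noteq> 0 \<and> F dvd smult e P"
proof -
  obtain F where F: "F \<in> ideal_gen S" "F \<noteq> 0"
    and min: "\<And>P. P \<in> ideal_gen S \<Longrightarrow> P \<noteq> 0 \<Longrightarrow> degree F \<le> degree P"
    using ex_has_least_nat[of "\<lambda>F. F \<in> ideal_gen S \<and> F \<noteq> 0" p degree] assms ideal_base[of p S]
    by blast
  have "\<exists>e. e \<noteq> 0 \<and> F dvd smult e P" if P: "P \<in> ideal_gen S" for P
  proof -
    obtain Q R where QR: "pseudo_divmod P F = (Q, R)" by (meson prod.exhaust)
    let ?e = "coeff F (degree F) ^ (Suc (degree P) - degree F)"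
    note div = pseudo_divmod[OF F(2) QR]
    have "R = [:?e:] * P - Q * F" using div(1) by (simp add: algebra_simps)
    then have "R \<in> ideal_gen S" using ideal_diff[OF ideal_scale[OF P, of "[:?e:]"] ideal_scale[OF F(1), of Q]] by simp
    then have "R = 0" using div(2) min by (metis leD)
    moreover have "?e \<noteq> 0" using F(2) by simp
    ultimately show ?thesis using div(1) by (metis add.right_neutral dvd_triv_left)
  qed
  with F show ?thesis using that by blast
qed

lemma ideal_gen_principal:
  fixes S :: "'k::field poly set"
  obtains f where "f \<in> ideal_gen S" "\<And>p. p \<in> ideal_gen S \<Longrightarrow> f dvd p"
proof (cases "\<exists>p\<in>S. p \<noteq> 0")
  case True
  then obtain p where p: "p \<in> S" "p \<noteq> 0" by blast
  show ?thesis
  proof (rule ideal_gen_pseudo_principal[OF p])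
    fix F
    assume F: "F \<in> ideal_gen S" and dvd: "\<And>P. P \<in> ideal_gen S \<Longrightarrow> \<exists>e. e \<noteq> 0 \<and> F dvd smult e P"
    have "F dvd P" if "P \<in> ideal_gen S" for P using dvd[OF that] dvd_smult_cancel by metis
    with F show ?thesis by (rule that)
  qed
next
  case False
  then have "\<And>p. p \<in> ideal_gen S \<Longrightarrow> 0 dvd p" by (metis dvd_0_right dvd_ideal_gen)
  then show ?thesis using that ideal_zero by blast
qed

section \<open>Bivariate polynomials over a field\<close>

text \<open>
  A polynomial of type \<open>'k poly poly\<close> is read here as \<open>F(x, y)\<close> in \<open>k[y][x]\<close>: the outer variable is \<open>x\<close>,
  the inner one \<open>y\<close>. Polynomials in \<open>y\<close> alone are constants \<open>[:c:]\<close>, polynomials in \<open>x\<close> alone are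
  \<open>in_x p\<close>, and \<open>at_y q F\<close> is \<open>F(x, q)\<close>. The next property says that \<open>F\<close> has no factor in
  \<open>y\<close> alone.
\<close>

definition y_primitive :: "'k::field poly poly \<Rightarrow> bool" where
  "y_primitive F \<longleftrightarrow> (\<forall>p. [:p:] dvd F \<longrightarrow> is_unit p)"

text \<open>Splitting off a factor in \<open>y\<close> lowers the degree of the leading coefficient, so this stops.\<close>

lemma y_primitive_part:
  fixes F :: "'k::field poly poly"
  assumes "F \<noteq> 0"
  shows "\<exists>c G. F = smult c G \<and> y_primitive G"
  using assms
proof (induction "degree (lead_coeff F)" arbitrary: F rule: less_induct)
  case less
  show ?case
  proof (cases "y_primitive F")
    case True
    then show ?thesis by (intro exI[of _ 1] exI[of _ F]) simp
  next
    case False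
    then obtain p G where p: "\<not> is_unit p" and G: "F = smult p G"
      by (auto simp: y_primitive_def elim!: dvdE)
    have nz: "p \<noteq> 0" "G \<noteq> 0" using less.prems G by auto
    then have "degree p > 0" using p is_unit_iff_degree by blast
    moreover have "lead_coeff F = p * lead_coeff G" using G by (simp add: lead_coeff_smult)
    ultimately have "degree (lead_coeff G) < degree (lead_coeff F)"
      using nz by (simp add: degree_mult_eq)
    from less.hyps[OF this nz(2)] obtain c H where "G = smult c H" "y_primitive H" by blast
    then show ?thesis using G by (intro exI[of _ "p * c"] exI[of _ H]) simp
  qed
qed

lemma exists_prime_divisor:
  fixes e :: "'k::field poly"
  assumes "degree e > 0"
  obtains p where "prime_elem p" "p dvd e" "degree p > 0"
proof -
  obtain p where p: "p dvd e \<and> degree p > 0"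
    and min: "\<And>r. r dvd e \<and> degree r > 0 \<Longrightarrow> degree p \<le> degree r"
    using ex_has_least_nat[of "\<lambda>p. p dvd e \<and> degree p > 0" e degree] assms by auto
  have "irreducible p"
  proof (rule irreducibleI)
    show "p \<noteq> 0" using p by auto
    then show "\<not> is_unit p" using p by (simp add: is_unit_iff_degree)
  next
    fix a b assume ab: "p = a * b"
    then have nz: "a \<noteq> 0" "b \<noteq> 0" using p by auto
    have "degree a = 0 \<or> degree b = 0"
    proof (rule ccontr)
      assume *: "\<not> (degree a = 0 \<or> degree b = 0)"
      then have "degree p \<le> degree a" using min[of a] p ab by (metis dvd_mult_left gr0I)
      then show False using * nz ab by (simp add: degree_mult_eq)
    qed
    then show "is_unit a \<or> is_unit b" using nz by (simp add: is_unit_iff_degree)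
  qed
  then show ?thesis using that p field_poly_irreducible_imp_prime by blast
qed

text \<open>
  Gauss's lemma: a prime factor of \<open>e\<close> stays prime in \<open>k[y][x]\<close>, so it divides the cofactor of \<open>F\<close> and
  can be cancelled.
\<close>

lemma y_primitive_dvd_smult:
  fixes F :: "'k::field poly poly"
  assumes F: "y_primitive F"
  shows "e \<noteq> 0 \<Longrightarrow> F dvd smult e P \<Longrightarrow> F dvd P"
proof (induction "degree e" arbitrary: e rule: less_induct)
  case less
  show ?case
  proof (cases "degree e = 0")
    case True
    then have "is_unit e" using less.prems by (simp add: is_unit_iff_degree)
    then obtain e' where "e' * e = 1" by (metis dvdE mult.commute)
    then have "P = smult e' (smult e P)" by simp
    then show ?thesis using less.prems(2) by (metis dvd_smult)
  next
    case False
    then obtain p where p: "prime_elem p" "p dvd e" "degree p > 0"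
      using exists_prime_divisor by blast
    then obtain e' where e': "e = p * e'" by blast
    with less.prems have nz: "p \<noteq> 0" "e' \<noteq> 0" by auto
    obtain T where T: "smult e P = F * T" using less.prems by blast
    have "[:p:] dvd F * T" unfolding T[symmetric] e' by (simp add: const_poly_dvd_iff)
    moreover have "\<not> [:p:] dvd F" using F p(3) is_unit_iff_degree[OF nz(1)] by (auto simp: y_primitive_def)
    ultimately have "[:p:] dvd T" using lift_prime_elem_poly[OF p(1)] prime_elem_dvd_mult_iff by blast
    then obtain T' where "T = smult p T'" by (auto elim!: dvdE)
    then have "smult p (smult e' P) = smult p (F * T')" using T e' by simp
    then have "smult e' P = F * T'" using nz by (metis smult_cancel)
    moreover have "degree e' < degree e" using e' nz p(3) by (simp add: degree_mult_eq)
    ultimately show ?thesis using less.hyps[of e'] nz by simp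
  qed
qed

definition in_x :: "'k::field poly \<Rightarrow> 'k poly poly" where
  "in_x p = map_poly (\<lambda>c. [:c:]) p"

definition at_y :: "'k::field \<Rightarrow> 'k poly poly \<Rightarrow> 'k poly" where
  "at_y q P = map_poly (\<lambda>c. poly c q) P"

lemma coeff_in_x [simp]: "coeff (in_x p) i = [:coeff p i:]"
  by (simp add: in_x_def coeff_map_poly)

lemma coeff_at_y [simp]: "coeff (at_y q P) i = poly (coeff P i) q"
  by (simp add: at_y_def coeff_map_poly)

lemma in_x_0 [simp]: "in_x 0 = 0" and in_x_1 [simp]: "in_x 1 = 1"
  by (auto intro!: poly_eqI simp: coeff_pCons one_pCons split: nat.splits)

lemma sum_pCons_0: "(\<Sum>i\<in>A. [:f i:]) = [:\<Sum>i\<in>A. f i:]"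
  by (induction A rule: infinite_finite_induct) auto

lemma in_x_mult: "in_x (f * h) = in_x f * in_x h"
  by (rule poly_eqI) (simp add: coeff_mult sum_pCons_0 mult.commute)

lemma at_y_0 [simp]: "at_y q 0 = 0"
  and at_y_add [simp]: "at_y q (F + G) = at_y q F + at_y q G"
  and at_y_diff [simp]: "at_y q (F - G) = at_y q F - at_y q G"
  and at_y_mult [simp]: "at_y q (F * G) = at_y q F * at_y q G"
  and at_y_in_x [simp]: "at_y q (in_x f) = f"
  and at_y_const [simp]: "at_y q [:c:] = [:poly c q:]"
  and at_y_smult [simp]: "at_y q (smult c F) = smult (poly c q) (at_y q F)"
  by (auto intro!: poly_eqI simp: coeff_mult poly_sum coeff_pCons mult.commute split: nat.splits)

lemma at_y_dvd: "F dvd G \<Longrightarrow> at_y q F dvd at_y q G"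
  by (auto elim!: dvdE)

lemma infinite_nonroot:
  fixes p :: "'k::field poly"
  assumes "infinite Q" "p \<noteq> 0"
  obtains q where "q \<in> Q" "poly p q \<noteq> 0"
  using poly_roots_finite[OF assms(2)] assms(1) finite_subset[of Q "{x. poly p x = 0}"] by blast

lemma poly_eq_if_eq_on_infinite:
  fixes p r :: "'k::field poly"
  assumes "infinite Q" "\<And>q. q \<in> Q \<Longrightarrow> poly p q = poly r q"
  shows "p = r"
  using infinite_nonroot[OF assms(1), of "p - r"] assms(2) by fastforce

lemma at_y_eqI:
  assumes "infinite Q" "\<And>q. q \<in> Q \<Longrightarrow> at_y q F = at_y q G"
  shows "F = G"
  by (rule poly_eqI, rule poly_eq_if_eq_on_infinite[OF assms(1)]) (metis assms(2) coeff_at_y)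

text \<open>
  The remainder of a pseudo-division of \<open>P\<close> by \<open>F\<close> vanishes for almost every \<open>q \<in> Q\<close>, because after
  substituting \<open>q\<close> it has smaller degree than \<open>F(x, q)\<close> and is divisible by it.
\<close>

lemma y_primitive_dvd_if_dvd_at_y:
  fixes F P :: "'k::field poly poly"
  assumes F: "y_primitive F" and inf: "infinite Q"
    and dvd: "\<And>q. q \<in> Q \<Longrightarrow> at_y q F dvd at_y q P"
  shows "F dvd P"
proof -
  have F0: "F \<noteq> 0" using F unfolding y_primitive_def by (metis dvd_0_right not_is_unit_0)
  obtain S R where SR: "pseudo_divmod P F = (S, R)" by (meson prod.exhaust)
  let ?e = "coeff F (degree F) ^ (Suc (degree P) - degree F)"
  note div = pseudo_divmod[OF F0 SR]
  have "R = 0"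
  proof (rule ccontr)
    assume R: "R \<noteq> 0"
    then have "lead_coeff F * lead_coeff R \<noteq> 0" using F0 by simp
    from infinite_nonroot[OF inf this] obtain q where q: "q \<in> Q"
      and nz: "poly (lead_coeff F) q \<noteq> 0" "poly (lead_coeff R) q \<noteq> 0" by auto
    have "R = smult ?e P - F * S" using div(1) by simp
    then have "at_y q R = smult (poly ?e q) (at_y q P) - at_y q F * at_y q S" by simp
    then have "at_y q F dvd at_y q R" using dvd[OF q] by (metis dvd_diff dvd_smult dvd_triv_left)
    moreover have R': "at_y q R \<noteq> 0" using nz(2) by (metis coeff_at_y coeff_0)
    ultimately have "degree (at_y q F) \<le> degree (at_y q R)" by (rule dvd_imp_degree_le)
    moreover have "degree (at_y q F) \<ge> degree F" using nz(1) by (intro le_degree) simp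
    moreover have "degree (at_y q R) \<le> degree R"
      by (intro degree_le) (auto simp: coeff_eq_0)
    ultimately show False using div(2) R by simp
  qed
  then have "F dvd smult ?e P" using div(1) by simp
  moreover have "?e \<noteq> 0" using F0 by simp
  ultimately show ?thesis using y_primitive_dvd_smult[OF F] by blast
qed



text \<open>
  The \<open>y\<close>-degree of \<open>P\<close> does not exceed that of \<open>F\<close>; as \<open>y\<close>-degrees add up in products, none is left
  for \<open>T\<close>.
\<close>

lemma cofactor_in_x:
  fixes F T P :: "'k::field poly poly"
  assumes FT: "F * T = P" and F: "F \<noteq> 0"
    and deg: "\<And>i. \<exists>j. degree (coeff P i) \<le> degree (coeff F j)"
  shows "\<exists>\<tau>. T = in_x \<tau>"
proof -
  \<comment> \<open>\<open>top s A\<close> is the coefficient of \<open>y\<close> to the power \<open>s\<close> in \<open>A\<close>, a polynomial in \<open>x\<close>.\<close>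
  define top :: "nat \<Rightarrow> 'k poly poly \<Rightarrow> 'k poly" where
    "top s A = map_poly (\<lambda>c. coeff c s) A" for s A
  have coeff_top: "coeff (top s A) i = coeff (coeff A i) s" for s A i
    by (simp add: top_def coeff_map_poly)
  have coeff_prod: "coeff (p * r) (s + t) = coeff p s * coeff r t"
    if "degree p \<le> s" "degree r \<le> t" for p r :: "'k poly" and s t
  proof -
    have "coeff p i * coeff r (s + t - i) = 0" if "i \<noteq> s" for i
      using that \<open>degree p \<le> s\<close> \<open>degree r \<le> t\<close>
      by (cases "i < s") (auto simp: coeff_eq_0)
    then have "coeff (p * r) (s + t) = (\<Sum>i\<in>{s}. coeff p i * coeff r (s + t - i))"
      unfolding coeff_mult by (intro sum.mono_neutral_right) auto
    then show ?thesis by simp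
  qed
  have top_mult: "top (s + t) (A * C) = top s A * top t C"
    if "\<And>i. degree (coeff A i) \<le> s" "\<And>i. degree (coeff C i) \<le> t" for A C s t
    by (rule poly_eqI)
      (simp add: coeff_top coeff_mult[of A C] coeff_mult[of "top s A"] coeff_sum coeff_prod that)
  have max: "\<exists>s j. degree (coeff A j) = s \<and> coeff A j \<noteq> 0 \<and> (\<forall>i. degree (coeff A i) \<le> s)"
    if "A \<noteq> 0" for A :: "'k poly poly"
  proof -
    let ?I = "{i. coeff A i \<noteq> 0}"
    have fin: "finite ?I" by (rule finite_subset[of _ "{..degree A}"]) (auto intro: le_degree)
    have "lead_coeff A \<noteq> 0" using that by simp
    then have ne: "?I \<noteq> {}" by blast
    define s where "s = Max ((\<lambda>i. degree (coeff A i)) ` ?I)"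
    have "s \<in> (\<lambda>i. degree (coeff A i)) ` ?I" unfolding s_def using fin ne by (intro Max_in) auto
    moreover have "degree (coeff A i) \<le> s" for i
      using fin by (cases "coeff A i = 0") (auto simp: s_def intro!: Max_ge)
    ultimately show ?thesis by auto
  qed
  obtain s j where s: "degree (coeff F j) = s" "coeff F j \<noteq> 0" "\<And>i. degree (coeff F i) \<le> s"
    using max[OF F] by blast
  show ?thesis
  proof (cases "T = 0")
    case True
    then show ?thesis by (intro exI[of _ 0]) simp
  next
    case False
    then obtain t l where t: "degree (coeff T l) = t" "coeff T l \<noteq> 0" "\<And>i. degree (coeff T i) \<le> t"
      using max[OF False] by blast
    have "t = 0"
    proof (rule ccontr)
      assume "t \<noteq> 0"
      then have "degree (coeff P i) < s + t" for i
        using deg[of i] s(3) by (meson add_strict_increasing2 le_less_trans le_trans not_gr_zero less_add_same_cancel1)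
      then have "top (s + t) P = 0" by (intro poly_eqI) (simp add: coeff_top coeff_eq_0)
      then have "top s F * top t T = 0" using top_mult[of F s T t] s(3) t(3) FT by simp
      moreover have "coeff (top s F) j \<noteq> 0" "coeff (top t T) l \<noteq> 0"
        using s t by (auto simp: coeff_top)
      ultimately show False by (metis coeff_0 mult_eq_0_iff)
    qed
    then have "coeff T i = [:coeff (coeff T i) 0:]" for i
      using t(3)[of i] by (metis degree_0_id le_zero_eq)
    then have "T = in_x (top 0 T)" by (intro poly_eqI) (simp add: coeff_top)
    then show ?thesis by blast
  qed
qed

section \<open>Minors and cross differences of a linear system\<close>

text \<open>
  \<open>minor f h\<close> is \<open>f(x) h(y) - h(x) f(y)\<close>, and \<open>cross f h q\<close> is its value at \<open>y = q\<close>, the member of the pencil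
  of \<open>f\<close> and \<open>h\<close> that vanishes at \<open>q\<close>.
\<close>

definition minor :: "'k::field poly \<Rightarrow> 'k poly \<Rightarrow> 'k poly poly" where
  "minor f h = in_x f * [:h:] - in_x h * [:f:]"

definition cross :: "'k::field poly \<Rightarrow> 'k poly \<Rightarrow> 'k \<Rightarrow> 'k poly" where
  "cross f h q = smult (poly h q) f - smult (poly f q) h"

lemma at_y_minor [simp]: "at_y q (minor f h) = cross f h q"
  by (simp add: minor_def cross_def)

lemma poly_cross: "poly (cross f h q) t = poly h q * poly f t - poly f q * poly h t"
  by (simp add: cross_def)

lemma minor_diagonal: "poly (minor f h) [:0, 1:] = 0"
proof -
  have "poly (in_x p) [:0, 1:] = p" for p :: "'a poly"
    unfolding in_x_def pcompose_altdef[symmetric] by (rule pcompose_idR)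
  then show ?thesis by (simp add: minor_def)
qed

lemma minor_smult [simp]: "minor f (smult k f) = 0"
  by (rule poly_eqI) (simp add: minor_def mult.commute)

lemma proportional_if_coeff_minor_eq_0:
  assumes "coeff (minor f h) (degree f) = 0" "f \<noteq> 0"
  shows "\<exists>k. h = smult k f"
proof -
  have "coeff (minor f h) (degree f) = smult (lead_coeff f) h - smult (coeff h (degree f)) f"
    by (simp add: minor_def)
  then have "smult (lead_coeff f) h = smult (coeff h (degree f)) f" using assms by simp
  then have "h = smult (inverse (lead_coeff f) * coeff h (degree f)) f"
    using assms(2) by (metis smult_smult left_inverse smult_1_left leading_coeff_0_iff)
  then show ?thesis by blast
qed

lemma bivariate_nonroot:
  fixes F :: "'k::field poly poly"
  assumes "infinite (UNIV :: 'k set)" "F \<noteq> 0"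
  obtains q t where "poly (at_y q F) t \<noteq> 0"
proof -
  have "lead_coeff F \<noteq> 0" using assms by simp
  from infinite_nonroot[OF assms(1) this] obtain q where "poly (lead_coeff F) q \<noteq> 0" by blast
  then have "at_y q F \<noteq> 0" by (metis coeff_0 coeff_at_y)
  from infinite_nonroot[OF assms(1) this] show ?thesis using that by blast
qed

text \<open>
  Two members of a pencil recover its two generators, up to the factor that tells whether the two
  members are independent.
\<close>

lemma pencil_combinations:
  fixes f h :: "'k::field poly"
  shows "smult (poly f q') (cross f h q) - smult (poly f q) (cross f h q') = smult (poly (cross f h q) q') f"
    and "smult (poly h q') (cross f h q) - smult (poly h q) (cross f h q') = smult (poly (cross f h q) q') h"
  by (auto simp: cross_def algebra_simps intro!: poly_eqI)

text \<open>
  The members of the linear system vanishing at \<open>q\<close> and those vanishing at \<open>q'\<close> together span the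
  whole system as soon as \<open>q\<close> and \<open>q'\<close> have different images, and the whole system has no common
  factor.
\<close>

lemma common_divisor_of_crosses_is_unit:
  fixes \<Gamma> :: "'k::field poly set"
  assumes one: "1 \<in> ideal_gen \<Gamma>"
    and mem: "f\<^sub>0 \<in> \<Gamma>" "h\<^sub>0 \<in> \<Gamma>" and q: "poly (cross f\<^sub>0 h\<^sub>0 q) q' \<noteq> 0"
    and w: "\<And>f h. f \<in> \<Gamma> \<Longrightarrow> h \<in> \<Gamma> \<Longrightarrow> w dvd cross f h q"
      "\<And>f h. f \<in> \<Gamma> \<Longrightarrow> h \<in> \<Gamma> \<Longrightarrow> w dvd cross f h q'"
  shows "is_unit w"
proof -
  have "w dvd smult (poly (cross f\<^sub>0 h\<^sub>0 q) q') f\<^sub>0" "w dvd smult (poly (cross f\<^sub>0 h\<^sub>0 q) q') h\<^sub>0"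
    unfolding pencil_combinations[symmetric] using w mem by (auto intro!: dvd_diff dvd_smult)
  then have fh: "w dvd f\<^sub>0" "w dvd h\<^sub>0" using q by (auto dest: dvd_smult_cancel)
  have "w dvd l" if l: "l \<in> \<Gamma>" for l
  proof -
    have *: "w dvd l" if "p \<in> \<Gamma>" "w dvd p" "poly p q \<noteq> 0" for p
    proof -
      have "smult (poly p q) l = cross l p q + smult (poly l q) p" by (simp add: cross_def)
      then have "w dvd smult (poly p q) l" using w(1)[OF l that(1)] that(2)
        by (metis dvd_add dvd_smult)
      then show ?thesis using that(3) dvd_smult_cancel by blast
    qed
    have "poly f\<^sub>0 q \<noteq> 0 \<or> poly h\<^sub>0 q \<noteq> 0" using q by (auto simp: poly_cross)
    then show ?thesis using * fh mem by blast
  qed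
  with one show ?thesis by (rule dvd_ideal_gen)
qed

lemma no_common_root:
  fixes \<Gamma> :: "'k::field poly set"
  assumes "1 \<in> ideal_gen \<Gamma>"
  obtains l where "l \<in> \<Gamma>" "poly l q \<noteq> 0"
proof -
  have "\<exists>l\<in>\<Gamma>. poly l q \<noteq> 0"
  proof (rule ccontr)
    assume "\<not> (\<exists>l\<in>\<Gamma>. poly l q \<noteq> 0)"
    then have "[:-q, 1:] dvd l" if "l \<in> \<Gamma>" for l using that poly_eq_0_iff_dvd by blast
    then have "[:-q, 1:] dvd 1" using assms dvd_ideal_gen by blast
    then show False by (simp add: is_unit_iff_degree)
  qed
  then show ?thesis using that by blast
qed

text \<open>
  Modulo \<open>w(y)\<close> the polynomial \<open>P(x, y)\<close> is a multiple of \<open>w(x)\<close> of no larger \<open>x\<close>-degree, so the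
  multiplier \<open>B\<close> depends on \<open>y\<close> only, and \<open>P\<close> and \<open>w(x)\<close> have proportional coefficients.
\<close>

lemma coeffs_mod_ideal_pair:
  fixes w :: "'k::field poly" and P :: "'k poly poly"
  assumes P: "P \<in> ideal_gen {in_x w, [:w:]}" and deg: "degree P \<le> degree w" and w: "w \<noteq> 0"
  shows "\<exists>B. \<forall>i. w dvd coeff P i - smult (coeff w i) B"
proof -
  obtain u v where uv: "P = u * in_x w + v * [:w:]" using P by (auto simp: ideal_gen_pair)
  have degw: "degree (in_x w) = degree w" by (simp add: in_x_def degree_map_poly)
  have w0: "in_x w \<noteq> 0" using w by (metis at_y_in_x at_y_0)
  \<comment> \<open>Dividing \<open>v\<close> by \<open>w(x)\<close> makes the term with \<open>w(y)\<close> have \<open>x\<close>-degree below that of \<open>w\<close>. The leading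
      coefficient of \<open>w(x)\<close> is a constant, so \<open>e\<close> is an invertible scalar.\<close>
  obtain S R where SR: "pseudo_divmod v (in_x w) = (S, R)" by (meson prod.exhaust)
  define k where "k = Suc (degree v) - degree w"
  define e where "e = lead_coeff w ^ k"
  have e0: "e \<noteq> 0" using w by (simp add: e_def)
  have "coeff (in_x w) (degree (in_x w)) ^ (Suc (degree v) - degree (in_x w)) = [:e:]"
    by (simp add: degw e_def k_def[symmetric] poly_const_pow)
  then have SR': "smult [:e:] v = in_x w * S + R" and R: "R = 0 \<or> degree R < degree w"
    using pseudo_divmod[OF w0 SR] by (simp_all add: degw)
  define U where "U = smult [:e:] u + S * [:w:]"
  have U: "U * in_x w = smult [:e:] P - smult w R"
  proof -
    have "smult [:e:] P = smult [:e:] u * in_x w + smult [:e:] v * [:w:]"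
      by (simp add: uv smult_add_right)
    also have "\<dots> = U * in_x w + smult w R" by (simp add: SR' U_def algebra_simps)
    finally show ?thesis by simp
  qed
  have "degree (U * in_x w) \<le> degree w"
    unfolding U using R deg by (intro degree_diff_le) (auto intro: order.trans[OF degree_smult_le])
  then have "degree U = 0" using w0 by (cases "U = 0") (auto simp: degree_mult_eq degw)
  then obtain B where B: "U = [:B:]" by (metis degree_0_id)
  have "w dvd coeff P i - smult (coeff w i) (smult (1 / e) B)" for i
  proof -
    have "smult (coeff w i) B = smult e (coeff P i) - w * coeff R i"
      using arg_cong[OF U, of "\<lambda>p. coeff p i"] by (simp add: B)
    then have "w * coeff R i = smult e (coeff P i) - smult (coeff w i) B" by simp
    then have "smult (1 / e) (w * coeff R i) = coeff P i - smult (coeff w i) (smult (1 / e) B)"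
      using e0 by (simp add: smult_diff_right mult.commute del: mult_smult_right)
    then show ?thesis by (metis dvd_smult dvd_triv_left)
  qed
  then show ?thesis by blast
qed



definition minors :: "'k::field poly set \<Rightarrow> 'k poly poly set" where
  "minors \<Gamma> = {minor f h | f h. f \<in> \<Gamma> \<and> h \<in> \<Gamma>}"

definition crosses :: "'k::field poly set \<Rightarrow> 'k \<Rightarrow> 'k poly set" where
  "crosses \<Gamma> q = {cross f h q | f h. f \<in> \<Gamma> \<and> h \<in> \<Gamma>}"

section \<open>Lueroth's theorem for a base point free linear system\<close>

lemma gcd_of_minors:
  assumes "f\<^sub>0 \<in> \<Gamma>" "h\<^sub>0 \<in> \<Gamma>" "minor f\<^sub>0 h\<^sub>0 \<noteq> 0"
  obtains F c where "y_primitive F" "c \<noteq> 0" "smult c F \<in> ideal_gen (minors \<Gamma>)"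
    "\<And>f h. f \<in> \<Gamma> \<Longrightarrow> h \<in> \<Gamma> \<Longrightarrow> F dvd minor f h"
proof -
  have "minor f\<^sub>0 h\<^sub>0 \<in> minors \<Gamma>" using assms by (auto simp: minors_def)
  from ideal_gen_pseudo_principal[OF this assms(3)] obtain F\<^sub>0 where
    F\<^sub>0: "F\<^sub>0 \<in> ideal_gen (minors \<Gamma>)" "F\<^sub>0 \<noteq> 0"
    and dvd: "\<And>P. P \<in> ideal_gen (minors \<Gamma>) \<Longrightarrow> \<exists>e. e \<noteq> 0 \<and> F\<^sub>0 dvd smult e P" by metis
  obtain c F where F: "F\<^sub>0 = smult c F" "y_primitive F" using y_primitive_part[OF F\<^sub>0(2)] by blast
  have "F dvd minor f h" if "f \<in> \<Gamma>" "h \<in> \<Gamma>" for f h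
  proof -
    have "minor f h \<in> ideal_gen (minors \<Gamma>)" using that by (auto simp: minors_def intro: ideal_base)
    then obtain e where "e \<noteq> 0" "F\<^sub>0 dvd smult e (minor f h)" using dvd by blast
    moreover have "F dvd F\<^sub>0" by (simp add: F(1) dvd_smult)
    ultimately show ?thesis using y_primitive_dvd_smult[OF F(2)] dvd_trans by blast
  qed
  moreover have "c \<noteq> 0" using F\<^sub>0(2) F(1) by auto
  ultimately show ?thesis using that F F\<^sub>0(1) by blast
qed

lemma at_y_ideal_minors:
  assumes "P \<in> ideal_gen (minors \<Gamma>)"
  shows "at_y q P \<in> ideal_gen (crosses \<Gamma> q)"
  using assms
proof (induction rule: ideal_induct)
  case zero
  then show ?case by (simp add: ideal_zero)
next
  case (step c x y)
  have "at_y q x \<in> crosses \<Gamma> q" using step(1) by (fastforce simp: minors_def crosses_def)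
  then show ?case using step(2) by (simp add: ideal_add ideal_scale ideal_base)
qed

lemma diagonal_of_minors:
  assumes "P \<in> ideal_gen (minors \<Gamma>)"
  shows "poly P [:0, 1:] = 0"
  using assms by (induction rule: ideal_induct) (auto simp: minors_def minor_diagonal)

text \<open>
  Let \<open>w\<close> divide all members of the system that vanish at \<open>q\<close>. Then \<open>h(y) l(q)\<close> and \<open>l(y) h(q)\<close> agree
  modulo \<open>w(y)\<close> for every \<open>h\<close> in the system. So modulo \<open>w(y)\<close> the minors in \<open>x\<close> and \<open>y\<close>, scaled by \<open>l(q)\<close>,
  become multiples of the cross differences in \<open>x\<close> at \<open>q\<close>, which are divisible by \<open>w(x)\<close>.
\<close>

lemma ideal_minors_restricted_to_fibre:
  assumes P: "P \<in> ideal_gen (minors \<Gamma>)" and l: "l \<in> \<Gamma>"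
    and w: "\<And>f h. f \<in> \<Gamma> \<Longrightarrow> h \<in> \<Gamma> \<Longrightarrow> w dvd cross f h q"
  shows "smult [:poly l q:] P \<in> ideal_gen {in_x w, [:w:]}" (is "_ \<in> ?K")
  using P
proof (induction rule: ideal_induct)
  case zero
  then show ?case by (simp add: ideal_zero)
next
  case (step c x y)
  then obtain f h where fh: "f \<in> \<Gamma>" "h \<in> \<Gamma>" "x = minor f h" by (auto simp: minors_def)
  have "smult [:poly l q:] (minor f h)
      = [:l:] * in_x (cross f h q) + in_x f * [:cross h l q:] - in_x h * [:cross f l q:]"
    by (rule poly_eqI) (simp add: minor_def cross_def algebra_simps smult_diff_left)
  moreover have "in_x p \<in> ?K" "[:p:] \<in> ?K" if wp: "w dvd p" for p
  proof -
    obtain s where s: "p = s * w" using wp by (metis dvdE mult.commute)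
    have "in_x p = in_x s * in_x w" "[:p:] = [:s:] * [:w:]" by (simp_all add: s in_x_mult)
    then show "in_x p \<in> ?K" "[:p:] \<in> ?K" by (metis ideal_scale ideal_base insertI1 insertI2)+
  qed
  ultimately have "smult [:poly l q:] x \<in> ?K"
    unfolding fh(3) using w fh(1,2) l by (simp only:) (intro ideal_diff ideal_add ideal_scale; blast)
  then have "c * smult [:poly l q:] x + smult [:poly l q:] y \<in> ?K"
    using step(2) by (intro ideal_add ideal_scale)
  then show ?case by (simp add: smult_add_right)
qed

text \<open>
  Lueroth's theorem in the form needed: the cross differences of the whole system at \<open>q\<close> have the single
  cross difference \<open>b(q) a - a(q) b\<close> as gcd, for all \<open>q\<close> outside the zeros of \<open>B\<close>. The
  degree condition at such \<open>q\<close> says that homogenizing the gcd in degree \<open>r\<close> does not create a factor \<open>x\<^sub>2\<close>.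

  Let \<open>F\<close> be the primitive gcd of the minors, with \<open>c(y) F\<close> in their ideal, and let \<open>a\<close> be the leading
  coefficient of \<open>F\<close> in \<open>x\<close> and \<open>b\<close> a coefficient not proportional to it. For almost all \<open>q\<close>
  the polynomial \<open>F(y, q)\<close> divides \<open>c(y) (a(y) b(q) - b(y) a(q))\<close>. This yields an identity
  \<open>F(y, z) \<tau>(y) = c(y) (a(y) b(z) - b(y) a(z))\<close>, where the cofactor has no \<open>z\<close> because \<open>a\<close> and \<open>b\<close> are
  coefficients of \<open>F\<close>. Since \<open>F(y, z)\<close> has no factor in \<open>z\<close> alone, \<open>a\<close> and \<open>b\<close> are coprime; since it has no
  factor in \<open>y\<close> alone, the quotient \<open>c / \<tau>\<close> is a constant. The two are exchanged at the end if \<open>b\<close> has the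
  larger degree.
\<close>

theorem luroth_pencil:
  fixes \<Gamma> :: "'k::field poly set"
  assumes inf: "infinite (UNIV :: 'k set)"
    and one: "1 \<in> ideal_gen \<Gamma>"
    and mem: "f\<^sub>0 \<in> \<Gamma>" "h\<^sub>0 \<in> \<Gamma>" and nz: "minor f\<^sub>0 h\<^sub>0 \<noteq> 0"
  obtains a b B where "degree b \<le> degree a" "degree a > 0" "1 \<in> ideal_gen {a, b}" "minor a b \<noteq> 0"
    "B \<noteq> 0"
    "\<forall>q. poly B q \<noteq> 0 \<longrightarrow> degree (cross a b q) = degree a"
    "\<forall>q. poly B q \<noteq> 0 \<longrightarrow> cross a b q \<in> ideal_gen (crosses \<Gamma> q)"
    "\<forall>q. \<forall>f\<in>\<Gamma>. \<forall>h\<in>\<Gamma>. cross a b q dvd cross f h q"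
proof -
  obtain F c where F: "y_primitive F" and c: "c \<noteq> 0"
    and cF: "smult c F \<in> ideal_gen (minors \<Gamma>)"
    and dvd: "\<And>f h. f \<in> \<Gamma> \<Longrightarrow> h \<in> \<Gamma> \<Longrightarrow> F dvd minor f h"
    using gcd_of_minors[OF mem nz] by metis
  have F0: "F \<noteq> 0" using F unfolding y_primitive_def by (metis dvd_0_right not_is_unit_0)
  have dvd_q: "at_y q F dvd cross f h q" if "f \<in> \<Gamma>" "h \<in> \<Gamma>" for f h q
    using at_y_dvd[OF dvd[OF that], of q] by simp
  \<comment> \<open>\<open>F\<close> has no factor in \<open>x\<close> alone.\<close>
  have unit: "is_unit w" if "\<And>q. w dvd at_y q F" for w
  proof -
    obtain q q' where q: "poly (cross f\<^sub>0 h\<^sub>0 q) q' \<noteq> 0"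
      using bivariate_nonroot[OF inf nz] by (metis at_y_minor)
    show ?thesis
      by (rule common_divisor_of_crosses_is_unit[OF one mem q])
        (metis dvd_q dvd_trans that)+
  qed
  define r where "r = degree F"
  \<comment> \<open>All minors vanish on the diagonal \<open>x = y\<close>, a nonzero constant does not.\<close>
  have r0: "r > 0"
  proof (rule ccontr)
    assume "\<not> r > 0"
    then obtain k where k: "F = [:k:]" unfolding r_def by (metis degree_0_id not_gr_zero)
    then show False using diagonal_of_minors[OF cF] c F0 by simp
  qed
  have deg_q: "degree (at_y q F) \<le> r" for q
    unfolding r_def by (intro degree_le) (auto simp: coeff_eq_0)
  define a where "a = coeff F r"
  have a0: "a \<noteq> 0" using F0 by (simp add: a_def r_def)
  \<comment> \<open>Were all coefficients proportional to \<open>a\<close>, then \<open>F = a(y) u(x)\<close>, and both factors would be units.\<close>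
  obtain p where p: "\<And>k. coeff F p \<noteq> smult k a"
  proof (rule ccontr)
    assume no: "\<not> thesis"
    have "\<exists>k. coeff F p = smult k a" for p using no that by blast
    then obtain k where k: "\<And>p. coeff F p = smult (k p) a" by metis
    define u where "u = Poly (map k [0..<Suc r])"
    have "coeff F i = a * [:coeff u i:]" for i
      using k[of i] by (cases "i \<le> r")
        (auto simp: u_def coeff_Poly_eq nth_default_def r_def coeff_eq_0 simp del: upt_Suc)
    then have Fu: "F = smult a (in_x u)" by (intro poly_eqI) simp
    then have "[:a:] dvd F" by (metis dvd_triv_left mult_pCons_left mult_zero_left pCons_0_0 add.right_neutral)
    then have "is_unit a" using F by (simp add: y_primitive_def)
    have "is_unit u" by (rule unit) (simp add: Fu dvd_smult)
    then have "degree u = 0" by (metis is_unit_iff_degree not_is_unit_0)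
    moreover have "degree F = degree u" using a0 by (simp add: Fu in_x_def degree_map_poly)
    ultimately show False using r0 r_def by simp
  qed
  define b where "b = coeff F p"
  have ab: "minor a b \<noteq> 0" using proportional_if_coeff_minor_eq_0[of a b] a0 p unfolding b_def by (metis coeff_0)
  \<comment> \<open>Points of one fibre have the same fibre, read off from the coefficients \<open>a\<close> and \<open>b\<close>.\<close>
  have pq: "at_y q F dvd c * cross a b q" if q: "poly a q \<noteq> 0" for q
  proof -
    let ?w = "at_y q F"
    have coeff_r: "coeff ?w r \<noteq> 0" using q by (simp add: a_def)
    then have deg: "degree ?w = r" using deg_q[of q] le_degree[of ?w r] by simp
    obtain l where l: "l \<in> \<Gamma>" "poly l q \<noteq> 0" using no_common_root[OF one] by metis
    have "smult [:poly l q:] (smult c F) \<in> ideal_gen {in_x ?w, [:?w:]}"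
      by (rule ideal_minors_restricted_to_fibre[OF cF l(1) dvd_q])
    moreover have "degree (smult [:poly l q:] (smult c F)) \<le> degree ?w"
      unfolding deg r_def by (metis degree_smult_le order_trans)
    moreover have "?w \<noteq> 0" using coeff_r by (metis coeff_0)
    ultimately obtain D where D:
        "\<And>i. ?w dvd coeff (smult [:poly l q:] (smult c F)) i - smult (coeff ?w i) D"
      using coeffs_mod_ideal_pair[of "smult [:poly l q:] (smult c F)" ?w] by blast
    have "?w dvd smult (poly l q) (c * a) - smult (poly a q) D"
      "?w dvd smult (poly l q) (c * b) - smult (poly b q) D"
      using D[of r] D[of p] by (simp_all add: a_def b_def)
    then have "?w dvd smult (poly b q) (smult (poly l q) (c * a) - smult (poly a q) D)
        - smult (poly a q) (smult (poly l q) (c * b) - smult (poly b q) D)"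
      by (rule dvd_diff[OF dvd_smult dvd_smult])
    also have "\<dots> = smult (poly l q) (c * cross a b q)"
      by (simp add: cross_def algebra_simps smult_diff_right)
    finally show ?thesis using l(2) dvd_smult_cancel by blast
  qed
  have "F dvd in_x c * minor a b"
  proof (rule y_primitive_dvd_if_dvd_at_y[OF F])
    have "finite {q. poly a q = 0}" using a0 by (rule poly_roots_finite)
    from Diff_infinite_finite[OF this inf] show "infinite {q. poly a q \<noteq> 0}"
      by (simp add: set_diff_eq)
    show "at_y q F dvd at_y q (in_x c * minor a b)" if "q \<in> {q. poly a q \<noteq> 0}" for q
      using pq that by simp
  qed
  then obtain T where T: "F * T = in_x c * minor a b" by (metis dvdE)
  have "\<exists>j. degree (coeff (in_x c * minor a b) i) \<le> degree (coeff F j)" for i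
  proof -
    have "in_x c * minor a b = in_x (c * a) * [:b:] - in_x (c * b) * [:a:]"
      by (simp add: minor_def in_x_mult algebra_simps)
    then have "coeff (in_x c * minor a b) i = smult (coeff (c * a) i) b - smult (coeff (c * b) i) a"
      by simp
    moreover have "degree \<dots> \<le> max (degree b) (degree a)"
      by (rule order.trans[OF degree_diff_le_max max.mono]) (rule degree_smult_le)+
    ultimately show ?thesis unfolding a_def b_def by (metis max_def)
  qed
  from cofactor_in_x[OF T F0 this] obtain \<tau> where "T = in_x \<tau>" by blast
  with T have \<tau>: "at_y q F * \<tau> = c * cross a b q" for q
    by (metis at_y_in_x at_y_minor at_y_mult)
  obtain q\<^sub>1 q\<^sub>2 where \<delta>: "poly (cross a b q\<^sub>1) q\<^sub>2 \<noteq> 0"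
    using bivariate_nonroot[OF inf ab] by (metis at_y_minor)
  have \<tau>0: "\<tau> \<noteq> 0" using \<tau>[of q\<^sub>1] c \<delta> by auto
  \<comment> \<open>Two independent members of the pencil recover \<open>x = a\<close> and \<open>x = b\<close>.\<close>
  have \<tau>_dvd: "\<tau> dvd c * x" if "smult (poly x q\<^sub>2) (cross a b q\<^sub>1) - smult (poly x q\<^sub>1) (cross a b q\<^sub>2)
      = smult (poly (cross a b q\<^sub>1) q\<^sub>2) x" for x
  proof -
    have "\<tau> dvd smult (poly x q\<^sub>2) (c * cross a b q\<^sub>1) - smult (poly x q\<^sub>1) (c * cross a b q\<^sub>2)"
      unfolding \<tau>[symmetric] by (intro dvd_diff dvd_smult) auto
    also have "\<dots> = c * (smult (poly x q\<^sub>2) (cross a b q\<^sub>1) - smult (poly x q\<^sub>1) (cross a b q\<^sub>2))"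
      by (simp add: algebra_simps)
    also have "\<dots> = smult (poly (cross a b q\<^sub>1) q\<^sub>2) (c * x)" by (simp add: that)
    finally show ?thesis using \<delta> dvd_smult_cancel by blast
  qed
  obtain \<alpha> \<beta> where \<alpha>\<beta>: "c * a = \<tau> * \<alpha>" "c * b = \<tau> * \<beta>"
    using \<tau>_dvd pencil_combinations by (metis dvdE)
  have fq: "at_y q F = smult (poly b q) \<alpha> - smult (poly a q) \<beta>" for q
  proof -
    have "\<tau> * at_y q F = smult (poly b q) (c * a) - smult (poly a q) (c * b)"
      using \<tau>[of q] by (simp add: mult.commute[of \<tau>] cross_def right_diff_distrib)
    also have "\<dots> = \<tau> * (smult (poly b q) \<alpha> - smult (poly a q) \<beta>)"
      unfolding \<alpha>\<beta> by (simp add: right_diff_distrib)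
    finally show ?thesis using \<tau>0 by simp
  qed
  have "(\<tau> * \<alpha>) * (c * b) = (c * a) * (\<tau> * \<beta>)" by (simp only: \<alpha>\<beta>)
  then have "\<tau> * c * (\<alpha> * b) = \<tau> * c * (\<beta> * a)" by (simp only: ac_simps)
  then have \<alpha>b: "\<alpha> * b = \<beta> * a" using \<tau>0 c by simp
  have coprime: "1 \<in> ideal_gen {a, b}"
  proof -
    obtain e where e: "e \<in> ideal_gen {a, b}" "\<And>p. p \<in> ideal_gen {a, b} \<Longrightarrow> e dvd p"
      using ideal_gen_principal by blast
    then have "e dvd a" "e dvd b" by (auto intro: ideal_base)
    moreover have "F = in_x \<alpha> * [:b:] - in_x \<beta> * [:a:]"
      by (rule at_y_eqI[OF inf]) (simp add: fq)
    ultimately have "[:e:] dvd F" by (simp add: const_poly_dvd_iff dvd_diff[OF dvd_smult dvd_smult])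
    then have "is_unit e" using F by (simp add: y_primitive_def)
    then obtain e' where "e' * e = 1" by (metis dvdE mult.commute)
    then show ?thesis using ideal_scale[OF e(1), of e'] by simp
  qed
  then obtain u v where uv: "u * a + v * b = 1" by (metis ideal_gen_pair)
  \<comment> \<open>\<open>\<alpha>\<close> and \<open>\<beta>\<close> are proportional to the coprime pair \<open>a, b\<close>; the ratio \<open>\<kappa>\<close> is \<open>c / \<tau>\<close>.\<close>
  define \<kappa> where "\<kappa> = u * \<alpha> + v * \<beta>"
  have "\<kappa> * a = u * \<alpha> * a + v * (\<beta> * a)" "\<kappa> * b = u * (\<alpha> * b) + v * \<beta> * b"
    by (simp_all add: \<kappa>_def algebra_simps)
  then have "\<kappa> * a = \<alpha> * (u * a + v * b)" "\<kappa> * b = \<beta> * (u * a + v * b)"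
    unfolding \<alpha>b[symmetric] by (simp_all add: \<alpha>b algebra_simps)
  then have \<kappa>: "\<alpha> = \<kappa> * a" "\<beta> = \<kappa> * b" by (simp_all add: uv)
  then have fq': "at_y q F = \<kappa> * cross a b q" for q
    unfolding fq cross_def \<kappa> by (simp add: right_diff_distrib)
  then have "is_unit \<kappa>" using unit by simp
  then obtain k where k: "\<kappa> = [:k:]" "k dvd 1" using is_unit_poly_iff by blast
  then have k0: "k \<noteq> 0" by auto
  have atF: "at_y q F = smult k (cross a b q)" for q by (simp add: fq' k)
  have deg_cross: "degree (cross a b q) \<le> r" for q
    using deg_q[of q] k0 by (simp add: atF)
  have deg_ab: "degree x \<le> r" if "smult (poly x q\<^sub>2) (cross a b q\<^sub>1) - smult (poly x q\<^sub>1) (cross a b q\<^sub>2)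
      = smult (poly (cross a b q\<^sub>1) q\<^sub>2) x" for x
  proof -
    have "degree (smult (poly (cross a b q\<^sub>1) q\<^sub>2) x) \<le> r" unfolding that[symmetric]
      by (intro degree_diff_le order.trans[OF degree_smult_le] deg_cross)
    then show ?thesis using \<delta> by simp
  qed
  have degs: "degree a \<le> r" "degree b \<le> r" by (rule deg_ab, rule pencil_combinations)+
  have good: "degree (cross a b q) = r" "cross a b q \<in> ideal_gen (crosses \<Gamma> q)"
    if "poly (a * c) q \<noteq> 0" for q
  proof -
    have "coeff (at_y q F) r \<noteq> 0" using that by (simp add: a_def)
    then show "degree (cross a b q) = r" using deg_q[of q] le_degree[of "at_y q F" r] k0 by (simp add: atF)
    have "[:1 / (poly c q * k):] * at_y q (smult c F) \<in> ideal_gen (crosses \<Gamma> q)"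
      by (intro ideal_scale at_y_ideal_minors[OF cF])
    moreover have "[:1 / (poly c q * k):] * at_y q (smult c F) = cross a b q"
      using that k0 by (simp add: atF)
    ultimately show "cross a b q \<in> ideal_gen (crosses \<Gamma> q)" by simp
  qed
  have dvds: "cross a b q dvd cross f h q" if "f \<in> \<Gamma>" "h \<in> \<Gamma>" for f h q
    using dvd_q[OF that, of q] k0 by (metis atF smult_dvd_cancel)
  have ac: "a * c \<noteq> 0" using a0 c by simp
  have swap: "cross b a q = - cross a b q" for q by (simp add: cross_def)
  show ?thesis
  proof (cases "degree b \<le> degree a")
    case True
    have "degree a = r"
    proof -
      obtain q where "poly (a * c) q \<noteq> 0" using infinite_nonroot[OF inf ac] by blast
      then have "r = degree (cross a b q)" using good by simp
      also have "\<dots> \<le> degree a"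
        unfolding cross_def using True
        by (intro degree_diff_le) (auto intro: order.trans[OF degree_smult_le])
      finally show ?thesis using degs by simp
    qed
    then show ?thesis using that[of b a "a * c"] True r0 coprime ab ac good dvds by simp
  next
    case False
    have "degree b = r"
    proof -
      obtain q where "poly (a * c) q \<noteq> 0" using infinite_nonroot[OF inf ac] by blast
      then have "r = degree (cross a b q)" using good by simp
      also have "\<dots> \<le> degree b"
        unfolding cross_def using False
        by (intro degree_diff_le) (auto intro: order.trans[OF degree_smult_le])
      finally show ?thesis using degs by simp
    qed
    moreover have "minor b a \<noteq> 0" using ab by (simp add: minor_def)
    moreover have "1 \<in> ideal_gen {b, a}" using coprime by (simp add: insert_commute)
    moreover have "- cross a b q \<in> ideal_gen (crosses \<Gamma> q)" if "poly (a * c) q \<noteq> 0" for q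
      using ideal_scale[OF good(2)[OF that], of "-1"] by simp
    ultimately show ?thesis
      using that[of a b "a * c"] False r0 ac good(1) dvds by (simp add: swap)
  qed
qed



section \<open>A linear system composed with a pencil\<close>

lemma coprime_power:
  fixes a b :: "'a::comm_ring_1"
  assumes "1 \<in> ideal_gen {a, b}"
  shows "1 \<in> ideal_gen {a, b ^ k}"
proof (induction k)
  case 0
  show ?case using ideal_base[of 1 "{a, 1}"] by simp
next
  case (Suc k)
  obtain u v where uv: "1 = u * a + v * b" using assms by (auto simp: ideal_gen_pair)
  obtain u' v' where uv': "1 = u' * a + v' * b ^ k" using Suc by (auto simp: ideal_gen_pair)
  have "1 = u' * a + v' * b ^ k * (u * a + v * b)" using uv uv' by simp
  also have "\<dots> = (u' + v' * b ^ k * u) * a + (v' * v) * b ^ Suc k" by (simp add: algebra_simps)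
  finally show ?case unfolding ideal_gen_pair by blast
qed

lemma coprime_dvd_mult:
  fixes a b :: "'a::comm_ring_1"
  assumes "1 \<in> ideal_gen {a, b}" "a dvd b * x"
  shows "a dvd x"
proof -
  obtain u v where "1 = u * a + v * b" using assms(1) by (auto simp: ideal_gen_pair)
  then have "x = u * x * a + v * (b * x)" by (metis mult.assoc mult.commute mult.left_neutral distrib_right)
  then show ?thesis using assms(2) by (metis dvd_add dvd_mult dvd_triv_right)
qed

text \<open>
  This is the expansion in base \<open>a/b\<close>, homogenized: the lowest digit is determined modulo \<open>a\<close>, where \<open>b\<close> is
  invertible, and the rest is a multiple of \<open>a\<close>.
\<close>

lemma pencil_base_expansion:
  fixes a b g :: "'k::field poly"
  assumes a: "degree a = r" "r > 0" and b: "degree b \<le> r" and coprime: "1 \<in> ideal_gen {a, b}"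
  shows "degree g < Suc m * r \<Longrightarrow>
    \<exists>c. (\<forall>l. degree (c l) < r) \<and> g = (\<Sum>l\<le>m. c l * (a ^ l * b ^ (m - l)))"
proof (induction m arbitrary: g)
  case 0
  then show ?case by (intro exI[of _ "\<lambda>_. g"]) simp
next
  case (Suc m)
  obtain u v where uv: "1 = u * a + v * b ^ Suc m"
    using coprime_power[OF coprime, of "Suc m"] by (auto simp: ideal_gen_pair)
  have a0: "a \<noteq> 0" using a by auto
  define c\<^sub>0 where "c\<^sub>0 = (v * g) mod a"
  have deg_c\<^sub>0: "degree c\<^sub>0 < r" using degree_mod_less[OF a0, of "v * g"] a by (auto simp: c\<^sub>0_def)
  have "g - c\<^sub>0 * b ^ Suc m = (u * a + v * b ^ Suc m) * g - (v * g - a * (v * g div a)) * b ^ Suc m"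
    unfolding uv[symmetric] c\<^sub>0_def by (simp add: minus_mult_div_eq_mod)
  also have "\<dots> = a * (u * g + (v * g div a) * b ^ Suc m)" by (simp add: algebra_simps)
  finally obtain h where h: "g - c\<^sub>0 * b ^ Suc m = a * h" by blast
  have "degree h < Suc m * r"
  proof (cases "h = 0")
    case True
    then show ?thesis using a by simp
  next
    case False
    have "degree (c\<^sub>0 * b ^ Suc m) \<le> degree c\<^sub>0 + Suc m * degree b"
      using degree_mult_le[of c\<^sub>0 "b ^ Suc m"] degree_power_le[of b "Suc m"]
      by (simp only: mult.commute[of "degree b"])
    also have "\<dots> < r + Suc m * r" using deg_c\<^sub>0 b by (meson add_less_le_mono mult_le_mono2)
    finally have "degree (g - c\<^sub>0 * b ^ Suc m) < Suc (Suc m) * r"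
      using Suc.prems by (intro degree_diff_less) simp_all
    then have "degree a + degree h < Suc (Suc m) * r"
      unfolding h degree_mult_eq[OF a0 False] .
    then show ?thesis using a by simp
  qed
  from Suc.IH[OF this] obtain c where c: "\<forall>l. degree (c l) < r"
    "h = (\<Sum>l\<le>m. c l * (a ^ l * b ^ (m - l)))" by blast
  define c' where "c' l = (case l of 0 \<Rightarrow> c\<^sub>0 | Suc l \<Rightarrow> c l)" for l
  have "g = c\<^sub>0 * b ^ Suc m + a * h" using h by (simp add: algebra_simps)
  also have "\<dots> = (\<Sum>l\<le>Suc m. c' l * (a ^ l * b ^ (Suc m - l)))"
    unfolding sum.atMost_Suc_shift c(2) by (simp add: c'_def sum_distrib_left ac_simps)
  finally have "g = (\<Sum>l\<le>Suc m. c' l * (a ^ l * b ^ (Suc m - l)))" .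
  moreover have "degree (c' l) < r" for l using c(1) deg_c\<^sub>0 by (simp add: c'_def split: nat.split)
  ultimately show ?case by blast
qed

lemma smult_sum_right: "smult k (\<Sum>i\<in>S. f i) = (\<Sum>i\<in>S. smult k (f i))"
  by (induction S rule: infinite_finite_induct) (auto simp: smult_add_right)

text \<open>
  Each \<open>f\<close> is expanded as \<open>f(x) = C\<^sub>f(x, x)\<close>, where \<open>C\<^sub>f(x, y)\<close> is a form of degree \<open>m\<close> in \<open>a(y), b(y)\<close>
  with coefficients of degree below \<open>r\<close> in \<open>x\<close>. On the fibre through \<open>q\<close> the vector of the \<open>f(x)\<close> is
  proportional both to the vector of the \<open>f(q)\<close> and to that of the \<open>C\<^sub>f(x, q)\<close>. So the latter two are
  proportional modulo a polynomial of degree \<open>r\<close>, hence proportional as they stand. Comparing coefficients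
  of \<open>x\<close>, the forms \<open>P\<^sub>f(a, b)\<close> of degree \<open>m\<close> occurring in \<open>C\<^sub>f\<close> are \<open>f\<close> times a common polynomial
  \<open>E\<close>, and the degree bound \<open>m r \<le> d\<close> forces \<open>E\<close> to be constant.
\<close>

theorem forms_in_pencil:
  fixes \<Gamma> :: "'k::field poly set"
  assumes inf: "infinite (UNIV :: 'k set)"
    and one: "1 \<in> ideal_gen \<Gamma>"
    and deg: "\<And>f. f \<in> \<Gamma> \<Longrightarrow> degree f \<le> d"
    and top: "f\<^sub>0 \<in> \<Gamma>" "f\<^sub>0 \<noteq> 0" "degree f\<^sub>0 = d"
    and ab: "degree b \<le> degree a" "degree a > 0" "1 \<in> ideal_gen {a, b}" "minor a b \<noteq> 0"
    and B: "B \<noteq> 0" "\<forall>q. poly B q \<noteq> 0 \<longrightarrow> degree (cross a b q) = degree a"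
    and dvd: "\<forall>q. \<forall>f\<in>\<Gamma>. \<forall>h\<in>\<Gamma>. cross a b q dvd cross f h q"
  obtains m where "d = m * degree a"
    "\<forall>f\<in>\<Gamma>. \<exists>e. f = (\<Sum>l\<le>m. smult (e l) (a ^ l * b ^ (m - l)))"
proof -
  define r where "r = degree a"
  define m where "m = d div r"
  have r: "degree a = r" "r > 0" "degree b \<le> r" using ab by (auto simp: r_def)
  have d_less: "d < Suc m * r" using r(2) by (simp add: m_def dividend_less_div_times add.commute)
  have mr: "m * r \<le> d" by (simp add: m_def)
  have "\<exists>c. (\<forall>l. degree (c l) < r) \<and> f = (\<Sum>l\<le>m. c l * (a ^ l * b ^ (m - l)))"
    if "f \<in> \<Gamma>" for f
    using pencil_base_expansion[OF r ab(3), of f m] deg[OF that] d_less by auto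
  then obtain c where c: "\<And>f l. f \<in> \<Gamma> \<Longrightarrow> degree (c f l) < r"
    "\<And>f. f \<in> \<Gamma> \<Longrightarrow> f = (\<Sum>l\<le>m. c f l * (a ^ l * b ^ (m - l)))"
    by metis
  \<comment> \<open>\<open>C f q\<close> is \<open>C\<^sub>f(x, q)\<close>, and \<open>P f s\<close> is the coefficient of \<open>x\<close> to the power \<open>s\<close> in \<open>C\<^sub>f(x, y)\<close>.\<close>
  define M where "M l = a ^ l * b ^ (m - l)" for l
  define C where "C f q = (\<Sum>l\<le>m. smult (poly (M l) q) (c f l))" for f q
  define P where "P f s = (\<Sum>l\<le>m. smult (coeff (c f l) s) (M l))" for f s
  have coeff_C: "coeff (C f q) s = poly (P f s) q" for f q s
    by (simp add: C_def P_def coeff_sum poly_sum mult.commute)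
  have deg_C: "degree (C f q) < r" if "f \<in> \<Gamma>" for f q
    unfolding C_def using c(1)[OF that] r(2)
    by (intro degree_sum_less) (auto intro: le_less_trans[OF degree_smult_le])
  have b0: "b \<noteq> 0" using ab(4) by (auto simp: minor_def)
  have proportional_q: "smult (poly h q) (C f q) = smult (poly f q) (C h q)"
    if fh: "f \<in> \<Gamma>" "h \<in> \<Gamma>" and q: "poly (B * b) q \<noteq> 0" for f h q
  proof -
    define w where "w = cross a b q"
    define \<beta> where "\<beta> = poly b q"
    have \<beta>: "\<beta> \<noteq> 0" and deg_w: "degree w = r" using q B(2) r(1) by (auto simp: \<beta>_def w_def)
    have w: "w = smult \<beta> a - smult (poly a q) b" by (simp add: w_def cross_def \<beta>_def)
    \<comment> \<open>Modulo \<open>w\<close> the ratio \<open>a/b\<close> equals its value at \<open>q\<close>.\<close>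
    have w_dvd: "w dvd smult (\<beta> ^ m) f - b ^ m * C f q" if f: "f \<in> \<Gamma>" for f
    proof -
      have "w dvd smult (\<beta> ^ m) (c f l * M l) - b ^ m * smult (poly (M l) q) (c f l)" if "l \<le> m" for l
      proof -
        have "w dvd smult \<beta> a ^ l - smult (poly a q) b ^ l"
          unfolding w power_diff_sumr2 by simp
        moreover have "smult (\<beta> ^ m) (c f l * M l) - b ^ m * smult (poly (M l) q) (c f l)
            = smult (\<beta> ^ (m - l)) (b ^ (m - l) * c f l) * (smult \<beta> a ^ l - smult (poly a q) b ^ l)"
        proof -
          have "\<beta> ^ m = \<beta> ^ (m - l) * \<beta> ^ l" "b ^ m = b ^ (m - l) * b ^ l"
            using that by (simp_all flip: power_add)
          then show ?thesis
            by (simp add: M_def \<beta>_def[symmetric] smult_power right_diff_distrib ac_simps)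
        qed
        ultimately show ?thesis by (simp only: dvd_smult dvd_mult)
      qed
      then have "w dvd (\<Sum>l\<le>m. smult (\<beta> ^ m) (c f l * M l) - b ^ m * smult (poly (M l) q) (c f l))"
        by (intro dvd_sum) simp
      also have "\<dots> = smult (\<beta> ^ m) (\<Sum>l\<le>m. c f l * M l) - b ^ m * C f q"
        by (simp add: C_def sum_subtractf sum_distrib_left smult_sum_right)
      also have "(\<Sum>l\<le>m. c f l * M l) = f" using c(2)[OF f] by (simp add: M_def)
      finally show ?thesis .
    qed
    define H where "H = smult (poly h q) (C f q) - smult (poly f q) (C h q)"
    have "b ^ m * H = smult (\<beta> ^ m) (cross f h q)
        - smult (poly h q) (smult (\<beta> ^ m) f - b ^ m * C f q)
        + smult (poly f q) (smult (\<beta> ^ m) h - b ^ m * C h q)"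
      by (simp add: H_def cross_def algebra_simps smult_diff_right)
    moreover have "w dvd \<dots>"
      using bspec[OF bspec[OF spec[OF dvd, of q] fh(1)] fh(2)] w_dvd[OF fh(1)] w_dvd[OF fh(2)]
      unfolding w_def[symmetric] by (intro dvd_add[OF dvd_diff[OF dvd_smult dvd_smult] dvd_smult])
    ultimately have "w dvd b ^ m * H" by simp
    moreover have "1 \<in> ideal_gen {w, b}"
    proof -
      obtain u v where uv: "1 = u * a + v * b" using ab(3) by (auto simp: ideal_gen_pair)
      have "smult \<beta> (u * a + v * b) = u * w + (smult (poly a q) u + smult \<beta> v) * b"
        by (simp add: w algebra_simps smult_add_right)
      then have "smult \<beta> 1 \<in> ideal_gen {w, b}" unfolding uv[symmetric] ideal_gen_pair by blast
      from ideal_scale[OF this, of "[:inverse \<beta>:]"] show ?thesis using \<beta> by (simp add: one_pCons)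
    qed
    ultimately have "w dvd H" using coprime_dvd_mult coprime_power by blast
    moreover have "degree H < r" unfolding H_def using deg_C fh r(2)
      by (intro degree_diff_less) (auto intro: le_less_trans[OF degree_smult_le])
    ultimately have "H = 0" using deg_w by (metis dvd_imp_degree_le leD)
    then show ?thesis by (simp add: H_def)
  qed
  have inf': "infinite {q. poly (B * b) q \<noteq> 0}"
    using Diff_infinite_finite[OF poly_roots_finite inf, of "B * b"] B(1) b0 by (simp add: set_diff_eq)
  have proportional: "h * P f s = f * P h s" if "f \<in> \<Gamma>" "h \<in> \<Gamma>" for f h s
  proof (rule poly_eq_if_eq_on_infinite[OF inf'])
    fix q assume "q \<in> {q. poly (B * b) q \<noteq> 0}"
    then have "coeff (smult (poly h q) (C f q)) s = coeff (smult (poly f q) (C h q)) s"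
      using proportional_q[OF that] by simp
    then show "poly (h * P f s) q = poly (f * P h s) q" by (simp add: coeff_C)
  qed
  have "\<exists>E. \<forall>f\<in>\<Gamma>. x * P f s = f * E" if "x \<in> ideal_gen \<Gamma>" for x s
    using that
  proof (induction rule: ideal_induct)
    case zero
    then show ?case by (intro exI[of _ 0]) simp
  next
    case (step k h y)
    then obtain E where "\<forall>f\<in>\<Gamma>. y * P f s = f * E" by blast
    then show ?case using proportional[OF _ step(1)]
      by (intro exI[of _ "k * P h s + E"]) (simp add: algebra_simps)
  qed
  from this[OF one] obtain E where E: "\<And>f s. f \<in> \<Gamma> \<Longrightarrow> P f s = f * E s" by (metis mult_1)
  obtain s where s: "E s \<noteq> 0"
  proof (rule ccontr)
    assume no: "\<not> thesis"
    have "E s = 0" for s using that no by blast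
    then have "P f\<^sub>0 s = 0" for s using E[OF top(1)] by simp
    then have "C f\<^sub>0 q = 0" for q by (intro poly_eqI) (simp add: coeff_C)
    moreover have "poly (C f\<^sub>0 q) q = poly (\<Sum>l\<le>m. c f\<^sub>0 l * M l) q" for q
      by (simp add: C_def poly_sum mult.commute)
    ultimately have "poly f\<^sub>0 q = poly 0 q" for q using c(2)[OF top(1)] by (simp add: M_def)
    then have "f\<^sub>0 = 0" using poly_eq_if_eq_on_infinite[OF inf] by blast
    then show False using top by simp
  qed
  have "degree (M l) \<le> m * r" if "l \<le> m" for l
  proof -
    have "degree (M l) \<le> degree a * l + degree b * (m - l)"
      unfolding M_def by (meson degree_mult_le degree_power_le add_mono order_trans)
    also have "\<dots> \<le> r * l + r * (m - l)" using r by (intro add_mono mult_right_mono) auto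
    also have "\<dots> = m * r" using that by (metis add_mult_distrib2 le_add_diff_inverse mult.commute)
    finally show ?thesis .
  qed
  then have "degree (P f\<^sub>0 s) \<le> m * r" unfolding P_def
    by (intro degree_sum_le) (auto intro: order.trans[OF degree_smult_le])
  moreover have "degree (P f\<^sub>0 s) = d + degree (E s)"
    using E[OF top(1)] top s by (simp add: degree_mult_eq)
  ultimately have Es: "degree (E s) = 0" and dmr: "d = m * r" using mr by auto
  from Es obtain e where e: "E s = [:e:]" by (metis degree_0_id)
  have "\<exists>e. f = (\<Sum>l\<le>m. smult (e l) (a ^ l * b ^ (m - l)))" if "f \<in> \<Gamma>" for f
  proof -
    have "smult e f = P f s" using E[OF that] e by simp
    moreover have "e \<noteq> 0" using s e by auto
    ultimately have "f = smult (inverse e) (P f s)" by (metis smult_smult left_inverse smult_1_left)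
    also have "\<dots> = (\<Sum>l\<le>m. smult (inverse e * coeff (c f l) s) (a ^ l * b ^ (m - l)))"
      by (simp add: P_def M_def smult_sum_right)
    finally show ?thesis by (intro exI[of _ "\<lambda>l. inverse e * coeff (c f l) s"])
  qed
  then show ?thesis using that[of m] dmr r by simp
qed



section \<open>General pairs of points\<close>

definition affine_vec :: "'k::field \<Rightarrow> 'k vec" where
  "affine_vec s = vec 2 (\<lambda>i. if i = 0 then s else 1)"

abbreviation affine_point :: "'k::field \<Rightarrow> 'k vec set" where
  "affine_point s \<equiv> proj_point (affine_vec s)"

lemma affine_vec [simp]: "affine_vec s \<in> carrier_vec 2" "affine_vec s $ 0 = s" "affine_vec s $ 1 = 1"
  "affine_vec s $ Suc 0 = 1" "affine_vec s \<noteq> 0\<^sub>v 2"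
proof -
  show *: "affine_vec s \<in> carrier_vec 2" "affine_vec s $ 0 = s" "affine_vec s $ 1 = 1" "affine_vec s $ Suc 0 = 1"
    by (simp_all add: affine_vec_def)
  show "affine_vec s \<noteq> 0\<^sub>v 2" using *(4) by (metis index_zero_vec(1) one_neq_zero One_nat_def lessI numeral_2_eq_2)
qed

lemma biform_scale:
  assumes "u \<in> carrier_vec 2" "v \<in> carrier_vec 2"
  shows "biform r s c (a \<cdot>\<^sub>v u) (b \<cdot>\<^sub>v v) = a ^ r * b ^ s * biform r s c u v"
proof -
  have *: "c i j * ((a * x) ^ i * (a * y) ^ (r - i)) * ((b * z) ^ j * (b * w) ^ (s - j))
      = a ^ r * b ^ s * (c i j * (x ^ i * y ^ (r - i)) * (z ^ j * w ^ (s - j)))"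
    if "i \<le> r" "j \<le> s" for i j x y z w
  proof -
    have "a ^ r = a ^ i * a ^ (r - i)" "b ^ s = b ^ j * b ^ (s - j)"
      using that by (simp_all flip: power_add)
    then show ?thesis by (simp add: power_mult_distrib ac_simps)
  qed
  have "(a \<cdot>\<^sub>v u) $ 0 = a * u $ 0" "(a \<cdot>\<^sub>v u) $ 1 = a * u $ 1"
    "(b \<cdot>\<^sub>v v) $ 0 = b * v $ 0" "(b \<cdot>\<^sub>v v) $ 1 = b * v $ 1" using assms by simp_all
  then show ?thesis unfolding biform_def sum_distrib_left by (simp only:) (intro sum.cong refl *; simp)
qed

lemma nonvanishing_iff:
  assumes "u \<in> carrier_vec 2" "v \<in> carrier_vec 2" "u \<noteq> 0\<^sub>v 2" "v \<noteq> 0\<^sub>v 2"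
  shows "(proj_point u, proj_point v) \<in> nonvanishing r s c \<longleftrightarrow> biform r s c u v \<noteq> 0"
proof -
  have "u \<in> proj_point u" "v \<in> proj_point v"
    by (auto simp: proj_point_def intro: exI[of _ 1])
  moreover have "proj_point u \<in> proj_space 2" "proj_point v \<in> proj_space 2"
    using assms by (simp_all add: proj_space_def)
  moreover have "biform r s c u' v' \<noteq> 0"
    if "biform r s c u v \<noteq> 0" "u' \<in> proj_point u" "v' \<in> proj_point v" for u' v'
    using that assms by (auto simp: proj_point_def biform_scale)
  ultimately show ?thesis by (auto simp: nonvanishing_def)
qed

definition bipoly :: "nat \<Rightarrow> nat \<Rightarrow> (nat \<Rightarrow> nat \<Rightarrow> 'k::field) \<Rightarrow> 'k poly poly" where
  "bipoly r s c = (\<Sum>i\<le>r. monom (\<Sum>j\<le>s. monom (c i j) j) i)"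

lemma biform_affine: "biform r s c (affine_vec x) (affine_vec y) = poly (at_y y (bipoly r s c)) x"
proof -
  have "at_y y (bipoly r s c) = (\<Sum>i\<le>r. monom (\<Sum>j\<le>s. c i j * y ^ j) i)"
    by (rule poly_eqI) (simp add: bipoly_def coeff_sum poly_sum poly_monom if_distrib sum.delta cong: if_cong)
  then show ?thesis by (simp add: biform_def poly_sum poly_monom sum_distrib_left sum_distrib_right ac_simps)
qed

lemma coeff_bipoly: "i \<le> r \<Longrightarrow> j \<le> s \<Longrightarrow> coeff (coeff (bipoly r s c) i) j = c i j"
  by (simp add: bipoly_def coeff_sum if_distrib cong: if_cong)

text \<open>
  Nonempty open sets contain the complement of a curve in the affine plane. This property survives
  finite intersections because the polynomial ring is a domain, so it passes from the generating sets to all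
  open sets.
\<close>

lemma open_contains_affine_nonvanishing:
  fixes W :: "('k::field vec set \<times> 'k vec set) set"
  assumes "generate_topology_on {nonvanishing r s c | r s c. True} W" "W \<noteq> {}"
  shows "\<exists>Y. Y \<noteq> 0 \<and> (\<forall>x y. poly (at_y y Y) x \<noteq> 0 \<longrightarrow> (affine_point x, affine_point y) \<in> W)"
  using assms
proof (induction rule: generate_topology_on.induct)
  case Empty
  then show ?case by simp
next
  case (Int U V)
  then obtain Y Z where "Y \<noteq> 0" "\<forall>x y. poly (at_y y Y) x \<noteq> 0 \<longrightarrow> (affine_point x, affine_point y) \<in> U"
    "Z \<noteq> 0" "\<forall>x y. poly (at_y y Z) x \<noteq> 0 \<longrightarrow> (affine_point x, affine_point y) \<in> V" by blast
  then show ?case by (intro exI[of _ "Y * Z"]) simp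
next
  case (UN K)
  then obtain V where "V \<in> K" "V \<noteq> {}" by blast
  with UN obtain Y where "Y \<noteq> 0" "\<forall>x y. poly (at_y y Y) x \<noteq> 0 \<longrightarrow> (affine_point x, affine_point y) \<in> V" by blast
  then show ?case using \<open>V \<in> K\<close> by blast
next
  case (Basis W)
  then obtain r s c where W: "W = nonvanishing r s c" by blast
  with Basis obtain q\<^sub>1 q\<^sub>2 where q: "(q\<^sub>1, q\<^sub>2) \<in> nonvanishing r s c" by auto
  then obtain u v where "q\<^sub>1 = proj_point u" "q\<^sub>2 = proj_point v"
    "u \<in> carrier_vec 2" "u \<noteq> 0\<^sub>v 2" "v \<in> carrier_vec 2" "v \<noteq> 0\<^sub>v 2"
    by (auto simp: nonvanishing_def proj_space_def)
  with q have "biform r s c u v \<noteq> 0" by (simp add: nonvanishing_iff)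
  then obtain i where i: "i \<le> r" "(\<Sum>j\<le>s. c i j * ((u $ 0) ^ i * (u $ 1) ^ (r - i)) * ((v $ 0) ^ j * (v $ 1) ^ (s - j))) \<noteq> 0"
    unfolding biform_def by (meson sum.not_neutral_contains_not_neutral atMost_iff)
  then obtain j where "j \<le> s" "c i j \<noteq> 0"
    by (metis (no_types, lifting) sum.not_neutral_contains_not_neutral atMost_iff mult_zero_left)
  then have "coeff (coeff (bipoly r s c) i) j \<noteq> 0" using i(1) by (simp add: coeff_bipoly)
  then have "bipoly r s c \<noteq> 0" by auto
  then show ?case unfolding W
    by (intro exI[of _ "bipoly r s c"]) (simp add: nonvanishing_iff biform_affine)
qed

text \<open>
  It suffices to treat pairs of affine points outside the zeros of one nonzero polynomial \<open>Z\<close>. In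
  the proof \<open>Z\<close> is homogenized in each variable to a degree \<open>N\<close> above its own, so that the resulting form
  also vanishes when one of the two points is at infinity.
\<close>

theorem for_general_pairsI:
  fixes Z :: "'k::field poly poly"
  assumes inf: "infinite (UNIV :: 'k set)" and Z: "Z \<noteq> 0"
    and Q: "\<And>x y. poly (at_y y Z) x \<noteq> 0 \<Longrightarrow> Q (affine_point x) (affine_point y)"
  shows "for_general_pairs Q"
proof -
  define N where "N = Suc (degree Z + (\<Sum>i\<le>degree Z. degree (coeff Z i)))"
  have N: "degree Z < N" by (simp add: N_def)
  have N': "degree (coeff Z i) < N" for i
  proof (cases "i \<le> degree Z")
    case True
    then have "degree (coeff Z i) \<le> (\<Sum>i\<le>degree Z. degree (coeff Z i))"
      by (intro member_le_sum) auto
    then show ?thesis by (simp add: N_def)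
  qed (simp add: coeff_eq_0 N_def)
  define c where "c i j = coeff (coeff Z i) j" for i j
  define U where "U = nonvanishing N N c"
  have bip: "bipoly N N c = Z"
  proof -
    have "(\<Sum>j\<le>N. monom (c i j) j) = coeff Z i" for i
      unfolding c_def using N'[of i] by (intro poly_as_sum_of_monoms') simp
    then show ?thesis unfolding bipoly_def using N by (simp add: poly_as_sum_of_monoms')
  qed
  have at_infinity: "u $ 1 \<noteq> 0" "v $ 1 \<noteq> 0" if "biform N N c u v \<noteq> 0" for u v
  proof -
    have cN: "c N j = 0" "c i N = 0" for i j using N N' by (simp_all add: c_def coeff_eq_0)
    show "u $ 1 \<noteq> 0"
    proof
      assume "u $ 1 = 0"
      then have "c i j * ((u $ 0) ^ i * (u $ 1) ^ (N - i)) * ((v $ 0) ^ j * (v $ 1) ^ (N - j)) = 0"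
        if "i \<le> N" for i j using that cN by (cases "i = N") auto
      then have "biform N N c u v = 0" unfolding biform_def by (intro sum.neutral ballI) simp
      with that show False by simp
    qed
    show "v $ 1 \<noteq> 0"
    proof
      assume "v $ 1 = 0"
      then have "c i j * ((u $ 0) ^ i * (u $ 1) ^ (N - i)) * ((v $ 0) ^ j * (v $ 1) ^ (N - j)) = 0"
        if "j \<le> N" for i j using that cN by (cases "j = N") auto
      then have "biform N N c u v = 0" unfolding biform_def by (intro sum.neutral ballI) simp
      with that show False by simp
    qed
  qed
  have affine: "\<exists>x a. u = a \<cdot>\<^sub>v affine_vec x \<and> a \<noteq> 0" if "u \<in> carrier_vec 2" "u $ 1 \<noteq> 0" for u :: "'k vec"
  proof -
    have "u = (u $ 1) \<cdot>\<^sub>v affine_vec (u $ 0 / u $ 1)"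
      using that by (intro eq_vecI) (auto simp: less_2_cases_iff affine_vec_def)
    then show ?thesis using that(2) by blast
  qed
  have point: "proj_point (a \<cdot>\<^sub>v w) = proj_point w" if "a \<noteq> 0" for a :: 'k and w
  proof -
    have "\<exists>b'. b = b' * a \<and> b' \<noteq> 0" if "b \<noteq> 0" for b
      using that \<open>a \<noteq> 0\<close> by (intro exI[of _ "b / a"]) auto
    then show ?thesis using that unfolding proj_point_def by (auto simp: smult_smult_assoc)
  qed
  have "Q q\<^sub>1 q\<^sub>2" if q: "(q\<^sub>1, q\<^sub>2) \<in> U" for q\<^sub>1 q\<^sub>2
  proof -
    obtain u v where uv: "q\<^sub>1 = proj_point u" "q\<^sub>2 = proj_point v"
      "u \<in> carrier_vec 2" "u \<noteq> 0\<^sub>v 2" "v \<in> carrier_vec 2" "v \<noteq> 0\<^sub>v 2"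
      using q by (auto simp: U_def nonvanishing_def proj_space_def)
    with q have nz: "biform N N c u v \<noteq> 0" by (simp add: U_def nonvanishing_iff)
    obtain x a where x: "u = a \<cdot>\<^sub>v affine_vec x" "a \<noteq> 0" using affine uv(3) at_infinity(1)[OF nz] by blast
    obtain y b where y: "v = b \<cdot>\<^sub>v affine_vec y" "b \<noteq> 0" using affine uv(5) at_infinity(2)[OF nz] by blast
    have "biform N N c (affine_vec x) (affine_vec y) \<noteq> 0" using nz by (simp add: x y biform_scale)
    then have "poly (at_y y Z) x \<noteq> 0" by (simp add: biform_affine bip)
    then show ?thesis using Q by (simp add: uv x y point)
  qed
  moreover have "openin zariski_P1_P1 U"
    unfolding zariski_P1_P1_def U_def by (rule topology_generated_by_Basis) blast
  moreover have "Abstract_Topology.closure_of zariski_P1_P1 U = topspace zariski_P1_P1"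
  proof -
    have "\<exists>y\<in>U. y \<in> W" if W: "openin zariski_P1_P1 W" "W \<noteq> {}" for W
    proof -
      have "generate_topology_on {nonvanishing r s c | r s c. True} W"
        using W(1) by (simp add: zariski_P1_P1_def openin_topology_generated_by_iff)
      from open_contains_affine_nonvanishing[OF this W(2)] obtain Y where
        Y: "Y \<noteq> 0" "\<And>x y. poly (at_y y Y) x \<noteq> 0 \<Longrightarrow> (affine_point x, affine_point y) \<in> W" by blast
      have "Y * Z \<noteq> 0" using Y(1) Z by simp
      from bivariate_nonroot[OF inf this] obtain y x where "poly (at_y y (Y * Z)) x \<noteq> 0" by blast
      then have "(affine_point x, affine_point y) \<in> W" "(affine_point x, affine_point y) \<in> U"
        using Y(2) by (auto simp: U_def nonvanishing_iff biform_affine bip)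
      then show ?thesis by blast
    qed
    then show ?thesis by (auto simp: closure_of_def)
  qed
  ultimately show ?thesis unfolding for_general_pairs_def by blast
qed



section \<open>Binary forms and their dehomogenization\<close>

text \<open>
  Products and homogeneous components are handled by the substitution \<open>f(x\<^sub>1, x\<^sub>2) \<mapsto> f(t s, s)\<close>, with
  \<open>s\<close> as outer and \<open>t\<close> as inner variable. It is an injective ring homomorphism, and the coefficient of \<open>s\<close>
  to the power \<open>e\<close> is the dehomogenization of the component of degree \<open>e\<close>. The inner coefficients go through
  \<open>scale_by\<close>, which is \<open>p(x\<^sub>1) \<mapsto> p(t s)\<close>.
\<close>

definition scale_by :: "'k::field poly \<Rightarrow> 'k poly poly" where
  "scale_by p = (\<Sum>i\<le>degree p. monom (monom (coeff p i) i) i)"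

lemma coeff_scale_by [simp]: "coeff (scale_by p) e = monom (coeff p e) e"
  by (auto simp: scale_by_def coeff_sum if_distrib coeff_eq_0 cong: if_cong)

lemma scale_by_0 [simp]: "scale_by 0 = 0" and scale_by_1 [simp]: "scale_by 1 = 1"
  and scale_by_add: "scale_by (p + q) = scale_by p + scale_by q"
  by (auto intro!: poly_eqI simp: monom_0 one_pCons coeff_pCons add_monom[symmetric] split: nat.split)

lemma scale_by_sum: "scale_by (\<Sum>i\<in>A. f i) = (\<Sum>i\<in>A. scale_by (f i))"
  by (induction A rule: infinite_finite_induct) (auto simp: scale_by_add)

lemma monom_sum_left: "monom (\<Sum>i\<in>A. f i) n = (\<Sum>i\<in>A. monom (f i) n)"
  by (induction A rule: infinite_finite_induct) (auto simp: add_monom[symmetric])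

lemma scale_by_mult: "scale_by (p * q) = scale_by p * scale_by q"
proof (rule poly_eqI)
  fix e
  have "monom (coeff p i * coeff q (e - i)) e = monom (coeff p i) i * monom (coeff q (e - i)) (e - i)"
    if "i \<le> e" for i using that by (simp add: mult_monom)
  then show "coeff (scale_by (p * q)) e = coeff (scale_by p * scale_by q) e"
    by (simp add: coeff_mult monom_sum_left)
qed

definition blowup :: "'k::field poly poly \<Rightarrow> 'k poly poly" where
  "blowup f = poly (map_poly scale_by f) [:0, 1:]"

lemma blowup_0 [simp]: "blowup 0 = 0" and blowup_1 [simp]: "blowup 1 = 1"
  by (simp_all add: blowup_def)

lemma blowup_add: "blowup (f + g) = blowup f + blowup g"
proof -
  have "map_poly scale_by (f + g) = map_poly scale_by f + map_poly scale_by g"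
    by (rule poly_eqI) (simp add: coeff_map_poly scale_by_add)
  then show ?thesis by (simp add: blowup_def)
qed

lemma blowup_mult: "blowup (f * g) = blowup f * blowup g"
proof -
  have "map_poly scale_by (f * g) = map_poly scale_by f * map_poly scale_by g"
    by (rule poly_eqI) (simp add: coeff_map_poly coeff_mult scale_by_mult scale_by_sum)
  then show ?thesis by (simp add: blowup_def)
qed

lemma coeff_blowup:
  "coeff (coeff (blowup f) e) i = (if i \<le> e then coeff (coeff f (e - i)) i else 0)"
proof -
  have X: "coeff (p * [:0, 1:] ^ j) e = (if j \<le> e then coeff p (e - j) else 0)" for p :: "'a poly poly" and j
  proof -
    have X: "[:0, 1:] ^ j = monom (1 :: 'a poly) j" by (simp add: monom_altdef)
    show ?thesis unfolding X mult.commute[of p] by (simp add: coeff_monom_mult)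
  qed
  define D where "D = degree (map_poly scale_by f) + e"
  have "blowup f = (\<Sum>j\<le>D. scale_by (coeff f j) * [:0, 1:] ^ j)"
    unfolding blowup_def poly_altdef D_def
    by (intro sum.mono_neutral_cong_left) (auto simp: coeff_map_poly intro!: le_degree)
  then have "coeff (coeff (blowup f) e) i
      = (\<Sum>j\<le>D. coeff (if j \<le> e then monom (coeff (coeff f j) (e - j)) (e - j) else 0) i)"
    by (simp add: coeff_sum X cong: if_cong)
  also have "\<dots> = (\<Sum>j\<le>D. if j = e - i \<and> i \<le> e then coeff (coeff f j) i else 0)"
    by (intro sum.cong) auto
  also have "\<dots> = (if i \<le> e then coeff (coeff f (e - i)) i else 0)"
    by (cases "i \<le> e") (auto simp: D_def)
  finally show ?thesis .
qed

lemma blowup_inject: "blowup f = blowup g \<longleftrightarrow> f = g"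
proof
  assume eq: "blowup f = blowup g"
  show "f = g"
  proof (intro poly_eqI)
    fix j i
    show "coeff (coeff f j) i = coeff (coeff g j) i"
      using coeff_blowup[of f "i + j" i] coeff_blowup[of g "i + j" i] eq by simp
  qed
qed simp

definition homogenize :: "nat \<Rightarrow> 'k::field poly \<Rightarrow> 'k poly poly" where
  "homogenize e p = (\<Sum>i\<le>e. monom (monom (coeff p i) i) (e - i))"

lemma coeff_homogenize:
  "coeff (coeff (homogenize e p) j) i = (if i + j = e then coeff p i else 0)"
proof -
  have "coeff (coeff (homogenize e p) j) i
      = (\<Sum>l\<le>e. if l = i \<and> e - l = j then coeff p l else 0)"
    unfolding homogenize_def coeff_sum by (intro sum.cong) auto
  also have "\<dots> = (\<Sum>l\<le>e. if l = i then (if i + j = e then coeff p i else 0) else 0)"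
    by (intro sum.cong) auto
  also have "\<dots> = (if i + j = e then coeff p i else 0)" by (auto simp: sum.delta)
  finally show ?thesis .
qed

lemma homogenize_0 [simp]: "homogenize e 0 = 0"
  and homogenize_add: "homogenize e (p + q) = homogenize e p + homogenize e q"
  and homogenize_diff: "homogenize e (p - q) = homogenize e p - homogenize e q"
  and homogenize_smult: "homogenize e (smult c p) = const2 c * homogenize e p"
  and homogenize_1: "homogenize e 1 = X2 ^ e"
proof -
  show "homogenize e 1 = X2 ^ e"
    unfolding X2_def monom_altdef[of 1, simplified, symmetric]
    by (intro poly_eqI) (auto simp: coeff_homogenize one_pCons coeff_pCons split: nat.split)
qed (auto intro!: poly_eqI simp: coeff_homogenize const2_def)

lemma homogenize_sum: "homogenize e (\<Sum>i\<in>A. f i) = (\<Sum>i\<in>A. homogenize e (f i))"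
  by (induction A rule: infinite_finite_induct) (auto simp: homogenize_add)

lemma blowup_homogenize: "degree p \<le> e \<Longrightarrow> blowup (homogenize e p) = monom p e"
  by (intro poly_eqI) (auto simp: coeff_blowup coeff_homogenize coeff_eq_0)

lemma homogenize_mult:
  assumes "degree p \<le> d" "degree q \<le> e"
  shows "homogenize (d + e) (p * q) = homogenize d p * homogenize e q"
proof -
  have "degree (p * q) \<le> d + e" using assms degree_mult_le by (meson add_mono order_trans)
  then show ?thesis
    using assms by (simp add: blowup_inject[symmetric] blowup_mult blowup_homogenize mult_monom)
qed

lemma homogenize_power: "degree p \<le> d \<Longrightarrow> homogenize (k * d) (p ^ k) = homogenize d p ^ k"
proof (induction k)
  case 0
  then show ?case using homogenize_1[of 0] by simp
next
  case (Suc k)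
  have "degree (p ^ k) \<le> k * d"
    using degree_power_le[of p k] Suc.prems by (metis mult.commute mult_le_mono1 order_trans)
  then show ?case using homogenize_mult[of p d "p ^ k" "k * d"] Suc by simp
qed

abbreviation dehomogenize :: "'k::field poly poly \<Rightarrow> 'k poly" where
  "dehomogenize f \<equiv> poly f 1"

lemma
  assumes "homogeneous d f"
  shows degree_dehomogenize: "degree (dehomogenize f) \<le> d"
    and homogenize_dehomogenize: "homogenize d (dehomogenize f) = f"
proof -
  have c: "coeff (dehomogenize f) i = (if i \<le> d then coeff (coeff f (d - i)) i else 0)" for i
  proof -
    have "coeff (dehomogenize f) i = (\<Sum>j\<le>degree f. coeff (coeff f j) i)"
      by (simp add: poly_altdef coeff_sum)
    also have "\<dots> = (\<Sum>j\<le>degree f. if j = d - i then (if i \<le> d then coeff (coeff f (d - i)) i else 0) else 0)"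
      using assms by (intro sum.cong) (auto simp: homogeneous_def, fastforce+)
    also have "\<dots> = (if i \<le> d then coeff (coeff f (d - i)) i else 0)"
      by (auto simp: sum.delta coeff_eq_0)
    finally show ?thesis .
  qed
  show "degree (dehomogenize f) \<le> d" by (intro degree_le) (simp add: c)
  show "homogenize d (dehomogenize f) = f"
    using assms by (intro poly_eqI) (auto simp: coeff_homogenize c homogeneous_def)
qed

lemma blowup_form: "homogeneous d f \<Longrightarrow> blowup f = monom (dehomogenize f) d"
  using blowup_homogenize[OF degree_dehomogenize] homogenize_dehomogenize by metis

lemma poly_homogenize_0: "poly (homogenize e p) 0 = monom (coeff p e) e"
  by (rule poly_eqI) (auto simp: poly_0_coeff_0 coeff_homogenize)

text \<open>
  Identities between dehomogenized polynomials lift to forms only after multiplication by a power of \<open>x\<^sub>2\<close>;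
  this removes that power. The value \<open>poly f 0\<close> is the restriction of \<open>f\<close> to \<open>x\<^sub>2 = 0\<close>.
\<close>

lemma dvd_X2_power_mult_cancel:
  assumes "poly f 0 \<noteq> 0"
  shows "f dvd X2 ^ N * \<psi> \<Longrightarrow> f dvd \<psi>"
proof (induction N)
  case (Suc N)
  then obtain w where w: "X2 * (X2 ^ N * \<psi>) = f * w" by (auto simp: mult.assoc)
  have "poly (f * w) 0 = 0" unfolding w[symmetric] by (simp add: X2_def)
  then have "poly w 0 = 0" using assms by simp
  then have "X2 dvd w" using poly_eq_0_iff_dvd[of w 0] by (simp add: X2_def)
  then obtain w' where "w = X2 * w'" by blast
  then have "X2 * (X2 ^ N * \<psi>) = X2 * (f * w')" using w by (simp add: ac_simps)
  then have "X2 ^ N * \<psi> = f * w'" by (simp add: X2_def)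
  then show ?case using Suc.IH by simp
qed simp

lemma homogenize_ideal:
  assumes "p \<in> ideal_gen S" "\<And>s. s \<in> S \<Longrightarrow> degree s \<le> d"
  shows "\<exists>N. \<forall>e\<ge>N. homogenize e p \<in> ideal_gen (homogenize d ` S)"
  using assms(1)
proof (induction rule: ideal_induct)
  case zero
  then show ?case by (auto simp: ideal_zero)
next
  case (step c x y)
  then obtain N where N: "\<And>e. e \<ge> N \<Longrightarrow> homogenize e y \<in> ideal_gen (homogenize d ` S)" by blast
  have "homogenize e (c * x + y) \<in> ideal_gen (homogenize d ` S)" if e: "e \<ge> max N (degree c + d)" for e
  proof -
    have "homogenize e (c * x) = homogenize (e - d) c * homogenize d x"
    proof -
      have "degree c \<le> e - d" "e - d + d = e" using e by auto
      then show ?thesis using homogenize_mult[of c "e - d" x d] assms(2)[OF step(1)] by simp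
    qed
    then show ?thesis unfolding homogenize_add using N e step(1)
      by (intro ideal_add) (auto intro: ideal_scale ideal_base)
  qed
  then show ?case by blast
qed

section \<open>Consequences of height two\<close>

text \<open>
  Divisibility by the homogenization of \<open>\<pi>\<close> can be tested on all homogeneous components at once, by
  divisibility of \<open>f(t s, s)\<close> by \<open>\<pi>(t)\<close>, and \<open>\<pi>(t)\<close> is prime in \<open>k[t][s]\<close>.
\<close>

lemma prime_elem_homogenize:
  fixes \<pi> :: "'k::field poly"
  assumes \<pi>: "prime_elem \<pi>"
  shows "prime_elem (homogenize (degree \<pi>) \<pi>)"
proof -
  let ?h = "homogenize (degree \<pi>) \<pi>"
  have dvd_iff: "?h dvd f \<longleftrightarrow> [:\<pi>:] dvd blowup f" for f
  proof
    assume "?h dvd f"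
    then obtain w where "f = ?h * w" by blast
    then have "blowup f = monom \<pi> (degree \<pi>) * blowup w" by (simp add: blowup_mult blowup_homogenize)
    moreover have "[:\<pi>:] dvd monom \<pi> (degree \<pi>)" by (simp add: const_poly_dvd_iff)
    ultimately show "[:\<pi>:] dvd blowup f" by simp
  next
    assume "[:\<pi>:] dvd blowup f"
    then have dvd: "\<pi> dvd coeff (blowup f) e" for e by (simp add: const_poly_dvd_iff)
    have deg: "degree (coeff (blowup f) e) \<le> e" for e by (intro degree_le) (simp add: coeff_blowup)
    have "blowup (\<Sum>e\<le>degree (blowup f). homogenize e (coeff (blowup f) e))
        = (\<Sum>e\<le>degree (blowup f). monom (coeff (blowup f) e) e)"
    proof -
      have "blowup (\<Sum>e\<in>A. F e) = (\<Sum>e\<in>A. blowup (F e))" for A :: "nat set" and F :: "nat \<Rightarrow> 'k poly poly"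
        by (induction A rule: infinite_finite_induct) (auto simp: blowup_add)
      then show ?thesis using deg by (simp add: blowup_homogenize)
    qed
    also have "\<dots> = blowup f" by (rule poly_as_sum_of_monoms)
    finally have f: "f = (\<Sum>e\<le>degree (blowup f). homogenize e (coeff (blowup f) e))"
      by (simp add: blowup_inject)
    have "?h dvd homogenize e (coeff (blowup f) e)" for e
    proof (cases "coeff (blowup f) e = 0")
      case False
      obtain u where u: "coeff (blowup f) e = \<pi> * u" using dvd by blast
      then have "\<pi> \<noteq> 0" "u \<noteq> 0" using False by auto
      then have "degree \<pi> + degree u \<le> e" using deg[of e] by (simp add: u degree_mult_eq)
      then have "homogenize e (coeff (blowup f) e) = ?h * homogenize (e - degree \<pi>) u"
        using homogenize_mult[of \<pi> "degree \<pi>" u "e - degree \<pi>"] by (simp add: u)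
      then show ?thesis by simp
    qed simp
    then show "?h dvd f" by (subst f) (intro dvd_sum)
  qed
  have P: "prime_elem [:\<pi>:]" using \<pi> by (rule lift_prime_elem_poly)
  show ?thesis
  proof (rule prime_elemI)
    show "?h \<noteq> 0" using blowup_homogenize[of \<pi> "degree \<pi>"] \<pi> by auto
    show "\<not> is_unit ?h" using P by (auto simp: dvd_iff prime_elem_def)
    show "?h dvd f \<or> ?h dvd g" if "?h dvd f * g" for f g
      using that P by (auto simp: dvd_iff blowup_mult prime_elem_dvd_mult_iff)
  qed
qed

lemma prime_elem_X2: "prime_elem X2"
proof -
  have iff: "X2 dvd f \<longleftrightarrow> poly f 0 = 0" for f :: "'a poly poly"
    using poly_eq_0_iff_dvd[of f 0] by (simp add: X2_def)
  show ?thesis by (rule prime_elemI) (auto simp: iff, simp add: X2_def)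
qed

text \<open>
  The principal ideal of \<open>h\<close> is a minimal nonzero prime: a nonzero element of least size in a
  nonzero prime inside it is \<open>h b\<close>, and \<open>b\<close>, being smaller, is not in that prime, so \<open>h\<close> is.
\<close>

lemma height_le_1_if_common_prime:
  fixes h :: "'k::field poly poly"
  assumes h: "prime_elem h" and I: "\<And>f. f \<in> I \<Longrightarrow> h dvd f"
  shows "height I \<le> 1"
proof -
  define P where "P = {f. h dvd f}"
  define msize where "msize f = degree f + degree (lead_coeff f)" for f :: "'k poly poly"
  have msize_mult: "msize (f * g) = msize f + msize g" if "f \<noteq> 0" "g \<noteq> 0" for f g
    unfolding msize_def lead_coeff_mult using that by (simp add: degree_mult_eq)
  have h0: "h \<noteq> 0" "\<not> is_unit h" using h by auto
  have msize_h: "msize h > 0"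
  proof (rule ccontr)
    assume "\<not> msize h > 0"
    then have "degree h = 0 \<and> degree (lead_coeff h) = 0" unfolding msize_def not_gr_zero add_is_0 .
    then have "is_unit h" using h0(1)
      by (metis degree_0_id is_unit_const_poly_iff is_unit_iff_degree leading_coeff_0_iff)
    then show False using h0 by simp
  qed
  have minimal: "Q = P" if Q: "prime_ideal Q" "Q \<subseteq> P" and nz: "f \<in> Q" "f \<noteq> 0" for Q f
  proof -
    have ideal: "is_ideal Q" using Q by (simp add: prime_ideal_def)
    obtain f where f: "f \<in> Q \<and> f \<noteq> 0" and min: "\<And>f'. f' \<in> Q \<and> f' \<noteq> 0 \<Longrightarrow> msize f \<le> msize f'"
      using ex_has_least_nat[of "\<lambda>f. f \<in> Q \<and> f \<noteq> 0" f msize] nz by blast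
    obtain b where b: "f = h * b" using f Q(2) by (auto simp: P_def)
    have "b \<notin> Q"
    proof
      assume "b \<in> Q"
      moreover have "b \<noteq> 0" using f b by auto
      ultimately have "msize f \<le> msize b" using min by blast
      then show False using msize_mult[OF h0(1) \<open>b \<noteq> 0\<close>] msize_h b by simp
    qed
    then have "h \<in> Q" using Q(1) f b by (auto simp: prime_ideal_def)
    then have "w * h \<in> Q" for w using module.subspace_scale[OF module_times ideal] by blast
    then show ?thesis using Q(2) by (auto simp: P_def mult.commute)
  qed
  have P: "prime_ideal P"
    unfolding prime_ideal_def
  proof (intro conjI allI impI)
    show "is_ideal P" by (rule is_idealI) (auto simp: P_def)
    show "P \<noteq> UNIV" using h0 by (auto simp: P_def)
    show "a \<in> P \<or> b \<in> P" if "a * b \<in> P" for a b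
      using that h by (auto simp: P_def prime_elem_dvd_mult_iff)
  qed
  have "r \<le> 1" if C: "\<forall>i\<le>r. prime_ideal (C i)" "\<forall>i<r. C i \<subset> C (Suc i)" "C r = P"
    for r and C :: "nat \<Rightarrow> 'k poly poly set"
  proof (rule ccontr)
    assume "\<not> r \<le> 1"
    then have "2 \<le> r" by simp
    then obtain s where s: "r = Suc (Suc s)" by (metis add_2_eq_Suc le_Suc_ex)
    have sub: "C s \<subset> C (Suc s)" "C (Suc s) \<subset> P" using C s by auto
    then obtain f where "f \<in> C (Suc s)" "f \<notin> C s" by blast
    moreover have "prime_ideal (C s)" using C(1) s by simp
    then have "0 \<in> C s" by (simp add: prime_ideal_def module.subspace_0[OF module_times])
    ultimately have "C (Suc s) = P" using minimal[of "C (Suc s)" f] C(1) s sub by auto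
    then show False using sub by blast
  qed
  then have "height_prime P \<le> 1"
    unfolding height_prime_def by (intro Sup_least) (auto simp: one_enat_def)
  moreover have "height I \<le> height_prime P"
    unfolding height_def using P I by (intro Inf_lower) (auto simp: P_def)
  ultimately show ?thesis by simp
qed

lemma height_UNIV: "height UNIV = \<infinity>"
proof -
  have *: "{height_prime P | P. prime_ideal P \<and> UNIV \<subseteq> P} = {}" by (auto simp: prime_ideal_def)
  show ?thesis unfolding height_def * by (simp add: top_enat_def)
qed



text \<open>
  A common prime factor of the forms would bound the height by one. Such a factor is \<open>x\<^sub>2\<close>, if all
  dehomogenizations have degree below \<open>d\<close>, or the homogenization of a common factor of the
  dehomogenizations. If all forms are proportional, they are constants by coprimality, and the ideal is the
  whole ring, of infinite height.
\<close>

lemma height_two_imp_pencil_conditions: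
  fixes G :: "'k::field poly poly set"
  assumes hom: "\<And>g. g \<in> G \<Longrightarrow> homogeneous d g" and height: "height (ideal_gen G) = 2"
  shows "1 \<in> ideal_gen (dehomogenize ` G)"
    and "\<exists>f\<^sub>0\<in>dehomogenize ` G. \<exists>h\<^sub>0\<in>dehomogenize ` G. f\<^sub>0 \<noteq> 0 \<and> degree f\<^sub>0 = d \<and> minor f\<^sub>0 h\<^sub>0 \<noteq> 0"
proof -
  let ?\<Gamma> = "dehomogenize ` G"
  have no_prime: False if "prime_elem h" "\<And>g. g \<in> G \<Longrightarrow> h dvd g" for h
  proof -
    have "height (ideal_gen G) \<le> 1"
      by (rule height_le_1_if_common_prime[OF that(1)]) (use that(2) in \<open>blast intro: dvd_ideal_gen\<close>)
    then show False by (simp add: height one_enat_def numeral_eq_enat)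
  qed
  have "\<exists>g\<in>G. coeff (dehomogenize g) d \<noteq> 0"
  proof (rule ccontr)
    assume no: "\<not> (\<exists>g\<in>G. coeff (dehomogenize g) d \<noteq> 0)"
    have "X2 dvd g" if g: "g \<in> G" for g
    proof -
      have "poly (homogenize d (dehomogenize g)) 0 = 0" using no g by (simp add: poly_homogenize_0)
      then show ?thesis using homogenize_dehomogenize[OF hom[OF g]] poly_eq_0_iff_dvd[of g 0]
        by (simp add: X2_def)
    qed
    then show False using no_prime prime_elem_X2 by blast
  qed
  then obtain g\<^sub>0 where g\<^sub>0: "g\<^sub>0 \<in> G" "coeff (dehomogenize g\<^sub>0) d \<noteq> 0" by blast
  define f\<^sub>0 where "f\<^sub>0 = dehomogenize g\<^sub>0"
  have f\<^sub>0: "f\<^sub>0 \<in> ?\<Gamma>" "f\<^sub>0 \<noteq> 0" using g\<^sub>0 by (auto simp: f\<^sub>0_def)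
  have deg: "degree f\<^sub>0 = d"
    using degree_dehomogenize[OF hom[OF g\<^sub>0(1)]] le_degree[OF g\<^sub>0(2)] by (simp add: f\<^sub>0_def)
  show one: "1 \<in> ideal_gen ?\<Gamma>"
  proof -
    obtain e where e: "e \<in> ideal_gen ?\<Gamma>" "\<And>p. p \<in> ideal_gen ?\<Gamma> \<Longrightarrow> e dvd p"
      using ideal_gen_principal by blast
    have "degree e = 0"
    proof (rule ccontr)
      assume "degree e \<noteq> 0"
      then obtain \<pi> where \<pi>: "prime_elem \<pi>" "\<pi> dvd e" using exists_prime_divisor by blast
      have "homogenize (degree \<pi>) \<pi> dvd g" if g: "g \<in> G" for g
      proof -
        have "e dvd dehomogenize g" using e(2) g by (blast intro: ideal_base)
        then obtain u where u: "dehomogenize g = \<pi> * u" using \<pi>(2) by (metis dvd_trans dvdE)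
        show ?thesis
        proof (cases "u = 0")
          case True
          then show ?thesis using u homogenize_dehomogenize[OF hom[OF g]] by (metis dvd_0_right homogenize_0 mult_zero_right)
        next
          case False
          then have "degree \<pi> + degree u \<le> d" using degree_dehomogenize[OF hom[OF g]] \<pi>(1)
            by (simp add: u degree_mult_eq)
          then have "homogenize d (\<pi> * u) = homogenize (degree \<pi>) \<pi> * homogenize (d - degree \<pi>) u"
            using homogenize_mult[of \<pi> "degree \<pi>" u "d - degree \<pi>"] by simp
          then show ?thesis using u homogenize_dehomogenize[OF hom[OF g]] by (metis dvd_triv_left)
        qed
      qed
      then show False using no_prime prime_elem_homogenize[OF \<pi>(1)] by blast
    qed
    moreover have "e dvd f\<^sub>0" using e(2) f\<^sub>0(1) by (blast intro: ideal_base)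
    then have "e \<noteq> 0" using f\<^sub>0(2) by auto
    ultimately have "is_unit e" by (simp add: is_unit_iff_degree)
    then obtain e' where "e' * e = 1" by (metis dvdE mult.commute)
    then show ?thesis using ideal_scale[OF e(1), of e'] by simp
  qed
  have "\<exists>h\<^sub>0\<in>?\<Gamma>. minor f\<^sub>0 h\<^sub>0 \<noteq> 0"
  proof (rule ccontr)
    assume no: "\<not> ?thesis"
    have "f\<^sub>0 dvd h" if "h \<in> ?\<Gamma>" for h
    proof -
      have "minor f\<^sub>0 h = 0" using no that by blast
      then obtain k where "h = smult k f\<^sub>0" using proportional_if_coeff_minor_eq_0[of f\<^sub>0 h] f\<^sub>0(2) by auto
      then show ?thesis by (simp add: dvd_smult)
    qed
    then have "is_unit f\<^sub>0" using one by (rule dvd_ideal_gen[rotated])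
    then have d0: "d = 0" using is_unit_iff_degree[OF f\<^sub>0(2)] deg by simp
    have "f\<^sub>0 = [:coeff f\<^sub>0 0:]" using deg d0 by (metis degree_0_id)
    moreover have "g\<^sub>0 = homogenize 0 f\<^sub>0"
      using homogenize_dehomogenize[OF hom[OF g\<^sub>0(1)]] d0 by (simp add: f\<^sub>0_def)
    ultimately have "g\<^sub>0 = homogenize 0 (smult (coeff f\<^sub>0 0) 1)" by simp
    then have "g\<^sub>0 = const2 (coeff f\<^sub>0 0)" unfolding homogenize_smult homogenize_1 by simp
    moreover have "coeff f\<^sub>0 0 \<noteq> 0" using g\<^sub>0(2) d0 by (simp add: f\<^sub>0_def)
    ultimately have "const2 (inverse (coeff f\<^sub>0 0)) * g\<^sub>0 = 1" by (simp add: const2_def one_pCons)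
    then have "1 \<in> ideal_gen G" using ideal_scale[OF ideal_base[OF g\<^sub>0(1)]] by metis
    then have "x \<in> ideal_gen G" for x using ideal_scale[of 1 G x] by simp
    then have "ideal_gen G = UNIV" by auto
    then show False using height by (simp add: height_UNIV numeral_eq_enat)
  qed
  then show "\<exists>f\<^sub>0\<in>?\<Gamma>. \<exists>h\<^sub>0\<in>?\<Gamma>. f\<^sub>0 \<noteq> 0 \<and> degree f\<^sub>0 = d \<and> minor f\<^sub>0 h\<^sub>0 \<noteq> 0" using f\<^sub>0 deg by blast
qed

section \<open>The greatest common divisor of the ideal of a fibre\<close>

lemma is_unit_const2:
  assumes "is_unit (u :: 'k::field poly poly)"
  obtains c where "u = const2 c" "c \<noteq> 0"
proof -
  obtain p where p: "u = [:p:]" "p dvd 1" using assms is_unit_poly_iff by blast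
  then obtain c where c: "p = [:c:]" "c dvd 1" using is_unit_poly_iff by blast
  then have "c \<noteq> 0" by auto
  with p c show ?thesis using that[of c] by (simp add: const2_def)
qed

text \<open>
  Write \<open>G\<^sub>i\<^sub>j = p\<^sub>j g\<^sub>i - p\<^sub>i g\<^sub>j\<close>. The syzygy \<open>g\<^sub>i e\<^sub>j - g\<^sub>j e\<^sub>i\<close> is a combination of columns of \<open>\<phi>\<close>,
  so \<open>G\<^sub>i\<^sub>j\<close> is a combination of entries of \<open>p\<phi>\<close>. Conversely \<open>g\<^sub>j\<close> times an entry of \<open>p\<phi>\<close> is a
  combination of the \<open>G\<^sub>i\<^sub>j\<close>, because the columns of \<open>\<phi>\<close> are syzygies. The powers of \<open>x\<^sub>2\<close> in the
  hypotheses come from homogenizing identities in one variable and can be cancelled because \<open>\<psi>\<close> and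
  one of the \<open>G\<^sub>i\<^sub>j\<close> are not divisible by \<open>x\<^sub>2\<close>.
\<close>

lemma gcd_of_fibre_ideal:
  fixes \<phi> :: "'k::field poly poly mat" and g :: "'k poly poly vec" and p :: "'k vec"
  assumes \<phi>: "\<phi> \<in> carrier_mat n l" and g: "g \<in> carrier_vec n" and p: "p \<in> carrier_vec n"
    and exact: "{\<phi> *\<^sub>v w | w. w \<in> carrier_vec l} = {v \<in> carrier_vec n. g \<bullet> v = 0}"
    and \<psi>: "poly \<psi> 0 \<noteq> 0"
    and \<psi>_dvd: "\<And>i j. i < n \<Longrightarrow> j < n \<Longrightarrow> \<psi> dvd const2 (p $ j) * g $ i - const2 (p $ i) * g $ j"
    and \<psi>_ideal: "X2 ^ N * \<psi> \<in> ideal_gen {const2 (p $ j) * g $ i - const2 (p $ i) * g $ j | i j. i < n \<and> j < n}"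
    and not_X2: "i\<^sub>0 < n" "j\<^sub>0 < n" "poly (const2 (p $ j\<^sub>0) * g $ i\<^sub>0 - const2 (p $ i\<^sub>0) * g $ j\<^sub>0) 0 \<noteq> 0"
    and one: "X2 ^ M \<in> ideal_gen (($) g ` {..<n})"
    and f: "is_gcd_of_ideal (ideal_gen (set\<^sub>v (transpose_mat \<phi> *\<^sub>v map_vec const2 p))) f"
  shows "\<exists>c. c \<noteq> 0 \<and> f = const2 c * \<psi>"
proof -
  define P where "P = map_vec const2 p"
  define w where "w = transpose_mat \<phi> *\<^sub>v P"
  have P: "P \<in> carrier_vec n" using p by (simp add: P_def)
  have w: "w \<in> carrier_vec l" unfolding w_def using \<phi> P by (intro mult_mat_vec_carrier[of _ l n]) simp_all
  obtain S where S: "ideal_gen S = ideal_gen (set\<^sub>v w)" "is_gcd S f"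
    using f by (auto simp: is_gcd_of_ideal_def w_def P_def)
  have kernel: "P \<bullet> v \<in> ideal_gen (set\<^sub>v w)" if v: "v \<in> carrier_vec n" "g \<bullet> v = 0" for v
  proof -
    have "v \<in> {\<phi> *\<^sub>v w | w. w \<in> carrier_vec l}" unfolding exact using v by simp
    then obtain x where x: "x \<in> carrier_vec l" "v = \<phi> *\<^sub>v x" by blast
    have "P \<bullet> v = w \<bullet> x" unfolding w_def x(2)
      using transpose_vec_mult_scalar[OF \<phi> x(1) P] by simp
    also have "\<dots> = (\<Sum>i<l. x $ i * w $ i)"
      using x(1) w by (simp add: scalar_prod_def mult.commute atLeast0LessThan)
    also have "\<dots> \<in> ideal_gen (set\<^sub>v w)"
      using w by (intro ideal_sum ideal_scale ideal_base) (auto simp: vec_set_def)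
    finally show ?thesis .
  qed
  let ?G = "\<lambda>i j. const2 (p $ j) * g $ i - const2 (p $ i) * g $ j"
  have G_mem: "?G i j \<in> ideal_gen (set\<^sub>v w)" if ij: "i < n" "j < n" for i j
  proof -
    define v where "v = g $ i \<cdot>\<^sub>v unit_vec n j - g $ j \<cdot>\<^sub>v unit_vec n i"
    have v: "v \<in> carrier_vec n" by (simp add: v_def)
    have sp: "x \<bullet> v = g $ i * x $ j - g $ j * x $ i" if "x \<in> carrier_vec n" for x
      unfolding v_def using that ij by (simp add: scalar_prod_minus_distrib[of _ n])
    have "P \<bullet> v \<in> ideal_gen (set\<^sub>v w)" by (rule kernel[OF v]) (simp add: sp[OF g])
    then show ?thesis using ij p by (simp add: sp[OF P]) (simp add: P_def mult.commute)
  qed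
  have f_dvd: "f dvd x" if "x \<in> ideal_gen (set\<^sub>v w)" for x
  proof (rule dvd_ideal_gen)
    show "x \<in> ideal_gen S" using that by (simp only: S(1))
    show "f dvd s" if "s \<in> S" for s using S(2) that by (simp add: is_gcd_def)
  qed
  have "f dvd X2 ^ N * \<psi>" by (rule dvd_ideal_gen[OF \<psi>_ideal]) (auto intro: f_dvd G_mem)
  moreover have "poly f 0 \<noteq> 0"
  proof -
    obtain t where "?G i\<^sub>0 j\<^sub>0 = f * t" using f_dvd[OF G_mem[OF not_X2(1,2)]] by blast
    then show ?thesis using not_X2(3) by auto
  qed
  ultimately have f\<psi>: "f dvd \<psi>" by (rule dvd_X2_power_mult_cancel[rotated])
  have "\<psi> dvd w $ k" if k: "k < l" for k
  proof -
    define c where "c = \<phi> *\<^sub>v unit_vec l k"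
    have c: "c \<in> carrier_vec n" using \<phi> by (simp add: c_def)
    have "c \<in> {\<phi> *\<^sub>v w | w. w \<in> carrier_vec l}" by (auto simp: c_def)
    then have "g \<bullet> c = 0" unfolding exact by simp
    then have gc: "(\<Sum>i<n. g $ i * c $ i) = 0" using c by (simp add: scalar_prod_def atLeast0LessThan)
    have "w $ k = w \<bullet> unit_vec l k" using w k by simp
    also have "\<dots> = P \<bullet> c" unfolding w_def c_def
      using transpose_vec_mult_scalar[OF \<phi> _ P, of "unit_vec l k"] by simp
    also have "\<dots> = (\<Sum>i<n. const2 (p $ i) * c $ i)"
      using c p by (simp add: scalar_prod_def atLeast0LessThan P_def)
    finally have wk: "w $ k = (\<Sum>i<n. const2 (p $ i) * c $ i)" .
    have g_dvd: "\<psi> dvd g $ j * w $ k" if j: "j < n" for j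
    proof -
      have "g $ j * w $ k = (\<Sum>i<n. const2 (p $ j) * (g $ i * c $ i) - ?G i j * c $ i)"
        unfolding wk sum_distrib_left by (intro sum.cong) (auto simp: algebra_simps)
      also have "\<dots> = - (\<Sum>i<n. ?G i j * c $ i)"
        by (simp only: sum_subtractf sum_distrib_left[symmetric] gc) simp
      finally have "g $ j * w $ k = - (\<Sum>i<n. ?G i j * c $ i)" .
      moreover have "\<psi> dvd (\<Sum>i<n. ?G i j * c $ i)"
        using \<psi>_dvd j by (intro dvd_sum dvd_mult2) auto
      ultimately show ?thesis by simp
    qed
    have "\<psi> dvd x * w $ k" if "x \<in> ideal_gen (($) g ` {..<n})" for x
      using that
    proof (induction rule: ideal_induct)
      case (step c x y)
      then have "\<psi> dvd c * (x * w $ k) + y * w $ k" using g_dvd by (intro dvd_add) auto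
      then show ?case by (simp add: algebra_simps)
    qed simp
    from this[OF one] show ?thesis by (rule dvd_X2_power_mult_cancel[OF \<psi>])
  qed
  then have w_dvd: "\<psi> dvd x" if "x \<in> set\<^sub>v w" for x
    using that w by (auto simp: vec_set_def)
  have "\<psi> dvd s" if "s \<in> S" for s
  proof (rule dvd_ideal_gen)
    show "s \<in> ideal_gen (set\<^sub>v w)" unfolding S(1)[symmetric] using that by (rule ideal_base)
  qed (rule w_dvd)
  then have "\<psi> dvd f" using S(2) by (simp add: is_gcd_def)
  then obtain u where u: "f = u * \<psi>" by (metis dvdE mult.commute)
  obtain v where "\<psi> = f * v" using f\<psi> by blast
  then have "u * v * \<psi> = 1 * \<psi>" using u by (simp add: ac_simps)
  moreover have "\<psi> \<noteq> 0" using \<psi> by auto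
  ultimately have "u * v = 1" by (metis mult_cancel_right)
  then have "is_unit u" by (metis dvd_triv_left)
  then show ?thesis using is_unit_const2 u by blast
qed



section \<open>Two general fibres generate\<close>

lemma subalgebra_adjoin: "subalgebra (adjoin S)"
  unfolding adjoin_def hull_def subalgebra_def by blast

lemma adjoin_superset: "S \<subseteq> adjoin S"
  unfolding adjoin_def by (rule hull_subset)

lemma adjoin_minimal: "S \<subseteq> A \<Longrightarrow> subalgebra A \<Longrightarrow> adjoin S \<subseteq> A"
  unfolding adjoin_def by (rule hull_minimal)

context
  fixes A :: "'k::field poly poly set"
  assumes A: "subalgebra A"
begin

lemma subalgebra_const: "const2 c \<in> A"
  and subalgebra_add: "x \<in> A \<Longrightarrow> y \<in> A \<Longrightarrow> x + y \<in> A"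
  and subalgebra_mult: "x \<in> A \<Longrightarrow> y \<in> A \<Longrightarrow> x * y \<in> A"
  using A by (auto simp: subalgebra_def)

lemma subalgebra_diff: "x \<in> A \<Longrightarrow> y \<in> A \<Longrightarrow> x - y \<in> A"
proof -
  assume "x \<in> A" "y \<in> A"
  then have "x + const2 (- 1) * y \<in> A" by (intro subalgebra_add subalgebra_mult subalgebra_const)
  moreover have "const2 (- 1) = (- 1 :: 'k poly poly)" by (simp add: const2_def one_pCons)
  ultimately show ?thesis by simp
qed

lemma subalgebra_power: "x \<in> A \<Longrightarrow> x ^ k \<in> A"
  using subalgebra_const[of 1] by (induction k) (auto simp: subalgebra_mult const2_def one_pCons)

lemma subalgebra_sum: "(\<And>i. i \<in> J \<Longrightarrow> F i \<in> A) \<Longrightarrow> sum F J \<in> A"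
  using subalgebra_const[of 0]
  by (induction J rule: infinite_finite_induct) (auto simp: subalgebra_add const2_def)

text \<open>
  In degree \<open>d\<close> the ideal consists of the linear combinations of its generators with constant
  coefficients: only the component of degree zero of a multiplier contributes.
\<close>

lemma forms_of_ideal_in_subalgebra:
  assumes G: "\<And>g. g \<in> G \<Longrightarrow> homogeneous d g" "G \<subseteq> A"
    and h: "h \<in> ideal_gen G" "homogeneous d h"
  shows "h \<in> A"
proof -
  have "homogenize d (coeff (blowup h) d) \<in> A" using h(1)
  proof (induction rule: ideal_induct)
    case zero
    then show ?case using subalgebra_const[of 0] by (simp add: const2_def)
  next
    case (step c x y)
    have "degree (coeff (blowup c) 0) = 0"
      using degree_le[of 0 "coeff (blowup c) 0"] by (simp add: coeff_blowup)
    then obtain k where k: "coeff (blowup c) 0 = [:k:]" by (metis degree_0_id)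
    have "coeff (blowup (c * x + y)) d = smult k (dehomogenize x) + coeff (blowup y) d"
      unfolding blowup_add blowup_mult blowup_form[OF G(1)[OF step(1)]] mult.commute[of "blowup c"]
      by (simp add: coeff_monom_mult k)
    then have "homogenize d (coeff (blowup (c * x + y)) d) = const2 k * x + homogenize d (coeff (blowup y) d)"
      using homogenize_dehomogenize[OF G(1)[OF step(1)]] by (simp add: homogenize_add homogenize_smult)
    then show ?case using step G(2) by (auto intro: subalgebra_add subalgebra_mult subalgebra_const)
  qed
  then show ?thesis using h(2) by (simp add: blowup_form homogenize_dehomogenize)
qed

lemma form_in_pencil_in_subalgebra:
  assumes a: "degree a \<le> r" "homogenize r a \<in> A" and b: "degree b \<le> r" "homogenize r b \<in> A"
  shows "homogenize (m * r) (\<Sum>l\<le>m. smult (e l) (a ^ l * b ^ (m - l))) \<in> A"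
proof -
  have "homogenize (m * r) (a ^ l * b ^ (m - l)) = homogenize r a ^ l * homogenize r b ^ (m - l)"
    if "l \<le> m" for l
  proof -
    have deg: "degree (p ^ k) \<le> k * r" if "degree p \<le> r" for p :: "'k poly" and k
      using degree_power_le[of p k] that by (metis mult.commute mult_le_mono1 order_trans)
    have "m * r = l * r + (m - l) * r" using that by (metis add_mult_distrib le_add_diff_inverse)
    then show ?thesis
      using homogenize_mult[OF deg[OF a(1)] deg[OF b(1)], of l "m - l"]
      by (simp add: homogenize_power a(1) b(1))
  qed
  then show ?thesis unfolding homogenize_sum homogenize_smult
    by (intro subalgebra_sum) (auto intro!: subalgebra_mult subalgebra_const subalgebra_power a b)
qed

end

lemma eval2_affine_vec: "eval2 f (affine_vec q) = poly (dehomogenize f) q"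
  by (simp add: eval2_def one_pCons)

theorem theorem4p2:
  fixes I :: "'k::field poly poly set"
    and g :: "'k poly poly vec"
    and \<phi> :: "'k poly poly mat"
    and n d :: nat
  assumes "infinite (UNIV :: 'k set)"
    and "perfect_field TYPE('k)"
    and "g \<in> carrier_vec n"
    and "\<forall>i<n. homogeneous d (g $ i)"
    and "minimally_generates g I"
    and "height I = 2"
    and "minimal_hilbert_burch g \<phi>"
  shows "for_general_pairs (\<lambda>q\<^sub>1 q\<^sub>2. \<forall>f\<^sub>1 f\<^sub>2.
           is_gcd_of_ideal (I1_at (proj_map g q\<^sub>1) \<phi>) f\<^sub>1 \<longrightarrow>
           is_gcd_of_ideal (I1_at (proj_map g q\<^sub>2) \<phi>) f\<^sub>2 \<longrightarrow>
           adjoin {h \<in> I. homogeneous d h} \<subseteq> adjoin {f\<^sub>1, f\<^sub>2})"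
proof -
  note inf = assms(1) and g = assms(3) and hom = assms(4)
  define G where "G = ($) g ` {..<n}"
  have dim: "dim_vec g = n" using g by simp
  have I: "I = ideal_gen G" using assms(5) dim by (simp add: minimally_generates_def G_def)
  have homG: "homogeneous d x" if "x \<in> G" for x using that hom by (auto simp: G_def)
  let ?\<Gamma> = "dehomogenize ` G"
  have \<phi>: "\<phi> \<in> carrier_mat n (n - 1)"
    and exact: "{\<phi> *\<^sub>v w | w. w \<in> carrier_vec (n - 1)} = {v \<in> carrier_vec n. g \<bullet> v = 0}"
    using assms(7) dim by (simp_all add: minimal_hilbert_burch_def Let_def)
  note conds = height_two_imp_pencil_conditions[OF homG assms(6)[unfolded I]]
  note one = conds(1)
  obtain f\<^sub>0 h\<^sub>0 where mem: "f\<^sub>0 \<in> ?\<Gamma>" "h\<^sub>0 \<in> ?\<Gamma>"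
    and f\<^sub>0: "f\<^sub>0 \<noteq> 0" "degree f\<^sub>0 = d" and minor: "minor f\<^sub>0 h\<^sub>0 \<noteq> 0"
    using conds(2) by blast
  obtain a b B where ab: "degree b \<le> degree a" "degree a > 0" "1 \<in> ideal_gen {a, b}" "minor a b \<noteq> 0"
    and B: "B \<noteq> 0" "\<forall>q. poly B q \<noteq> 0 \<longrightarrow> degree (cross a b q) = degree a"
    and in_ideal: "\<forall>q. poly B q \<noteq> 0 \<longrightarrow> cross a b q \<in> ideal_gen (crosses ?\<Gamma> q)"
    and cross_dvd: "\<forall>q. \<forall>f\<in>?\<Gamma>. \<forall>h\<in>?\<Gamma>. cross a b q dvd cross f h q"
    by (rule luroth_pencil[OF inf one mem minor]) blast
  have deg\<Gamma>: "degree f \<le> d" if "f \<in> ?\<Gamma>" for f using that degree_dehomogenize[OF homG] by auto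
  obtain m where dm: "d = m * degree a"
    and expand: "\<forall>f\<in>?\<Gamma>. \<exists>e. f = (\<Sum>l\<le>m. smult (e l) (a ^ l * b ^ (m - l)))"
    by (rule forms_in_pencil[OF inf one deg\<Gamma> mem(1) f\<^sub>0 ab B cross_dvd]) blast+
  define r where "r = degree a"
  \<comment> \<open>Where \<open>D\<close> does not vanish, the fibre does not contain the point at infinity \<open>x\<^sub>2 = 0\<close>.\<close>
  define D where "D = coeff (minor f\<^sub>0 h\<^sub>0) d"
  have D0: "D \<noteq> 0"
    using proportional_if_coeff_minor_eq_0[of f\<^sub>0 h\<^sub>0] f\<^sub>0 minor by (auto simp: D_def)
  have D: "poly D q = coeff (cross f\<^sub>0 h\<^sub>0 q) d" for q by (simp add: D_def flip: at_y_minor)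
  define \<psi> where "\<psi> q = homogenize r (cross a b q)" for q
  have gcd: "\<exists>c. c \<noteq> 0 \<and> f = const2 c * \<psi> q"
    if q: "poly (B * D) q \<noteq> 0" and f: "is_gcd_of_ideal (I1_at (proj_map g (affine_point q)) \<phi>) f" for q f
  proof -
    define p where "p = map_vec (\<lambda>f. eval2 f (affine_vec q)) g"
    have p: "p \<in> carrier_vec n" using g by (simp add: p_def)
    have pi: "p $ i = poly (dehomogenize (g $ i)) q" if "i < n" for i
      using that dim by (simp add: p_def eval2_affine_vec)
    have G: "const2 (p $ j) * g $ i - const2 (p $ i) * g $ j
        = homogenize d (cross (dehomogenize (g $ i)) (dehomogenize (g $ j)) q)" if "i < n" "j < n" for i j
      using that hom by (simp add: cross_def homogenize_diff homogenize_smult homogenize_dehomogenize pi)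
    have \<Gamma>: "dehomogenize (g $ i) \<in> ?\<Gamma>" if "i < n" for i using that by (auto simp: G_def)
    have deg: "degree (cross a b q) = r" using B(2) q by (simp add: r_def)
    have "cross a b q \<noteq> 0" using deg ab(2) by (auto simp: r_def)
    then have "coeff (cross a b q) r \<noteq> 0" using deg by auto
    then have \<psi>0: "poly (\<psi> q) 0 \<noteq> 0" by (simp add: \<psi>_def poly_homogenize_0)
    have \<psi>_dvd: "\<psi> q dvd const2 (p $ j) * g $ i - const2 (p $ i) * g $ j" if ij: "i < n" "j < n" for i j
    proof -
      let ?c = "cross (dehomogenize (g $ i)) (dehomogenize (g $ j)) q"
      obtain t where t: "?c = cross a b q * t" using cross_dvd \<Gamma>[OF ij(1)] \<Gamma>[OF ij(2)] by blast
      show ?thesis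
      proof (cases "t = 0")
        case True
        then show ?thesis by (simp add: G[OF ij] t)
      next
        case False
        have "degree ?c \<le> d" unfolding cross_def using deg\<Gamma>[OF \<Gamma>] ij
          by (intro degree_diff_le) (auto intro: order.trans[OF degree_smult_le])
        then have "r + degree t \<le> d"
          using False \<open>cross a b q \<noteq> 0\<close> deg by (simp add: t degree_mult_eq)
        then have "homogenize d ?c = \<psi> q * homogenize (d - r) t"
          using homogenize_mult[of "cross a b q" r t "d - r"] deg by (simp add: t \<psi>_def)
        then show ?thesis by (simp add: G[OF ij])
      qed
    qed
    let ?Gs = "{const2 (p $ j) * g $ i - const2 (p $ i) * g $ j | i j. i < n \<and> j < n}"
    have degc: "degree x \<le> d" if "x \<in> crosses ?\<Gamma> q" for x
      using that deg\<Gamma> unfolding crosses_def cross_def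
      by (auto intro!: degree_diff_le intro: order.trans[OF degree_smult_le])
    have "cross a b q \<in> ideal_gen (crosses ?\<Gamma> q)" using in_ideal q by simp
    from homogenize_ideal[OF this degc] obtain N where
      N: "\<forall>e\<ge>N. homogenize e (cross a b q) \<in> ideal_gen (homogenize d ` crosses ?\<Gamma> q)" by blast
    have eq: "homogenize (N + r) (cross a b q) = X2 ^ N * \<psi> q"
      using homogenize_mult[of 1 N "cross a b q" r] deg by (simp add: homogenize_1 \<psi>_def)
    have "homogenize d ` crosses ?\<Gamma> q \<subseteq> ?Gs"
    proof
      fix x assume "x \<in> homogenize d ` crosses ?\<Gamma> q"
      then obtain i j where ij: "i < n" "j < n"
        "x = homogenize d (cross (dehomogenize (g $ i)) (dehomogenize (g $ j)) q)"
        by (auto simp: crosses_def G_def)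
      then show "x \<in> ?Gs" using G[OF ij(1,2)] by force
    qed
    then have sub: "ideal_gen (homogenize d ` crosses ?\<Gamma> q) \<subseteq> ideal_gen ?Gs" by (rule ideal_mono)
    have "homogenize (N + r) (cross a b q) \<in> ideal_gen (homogenize d ` crosses ?\<Gamma> q)" using N by simp
    from subsetD[OF sub this] have \<psi>_ideal: "X2 ^ N * \<psi> q \<in> ideal_gen ?Gs" by (simp only: eq)
    obtain i\<^sub>0 j\<^sub>0 where ij: "i\<^sub>0 < n" "j\<^sub>0 < n" "f\<^sub>0 = dehomogenize (g $ i\<^sub>0)" "h\<^sub>0 = dehomogenize (g $ j\<^sub>0)"
      using mem by (auto simp: G_def)
    have not_X2: "poly (const2 (p $ j\<^sub>0) * g $ i\<^sub>0 - const2 (p $ i\<^sub>0) * g $ j\<^sub>0) 0 \<noteq> 0"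
      using q by (simp add: G ij poly_homogenize_0 D)
    from homogenize_ideal[OF one deg\<Gamma>] obtain M where
      M: "\<forall>e\<ge>M. homogenize e 1 \<in> ideal_gen (homogenize d ` ?\<Gamma>)" by blast
    have "homogenize d ` ?\<Gamma> = G"
      unfolding image_image using homogenize_dehomogenize[OF homG] by (simp cong: image_cong)
    then have X2_ideal: "X2 ^ M \<in> ideal_gen (($) g ` {..<n})" using M by (simp add: homogenize_1 G_def)
    have "proj_map g (affine_point q) = proj_point p"
      unfolding p_def by (rule proj_map_proj_point) (use hom dim in auto)
    then have "is_gcd_of_ideal (ideal_gen (set\<^sub>v (transpose_mat \<phi> *\<^sub>v map_vec const2 p))) f"
      using f I1_at_proj_point[of p \<phi>] p \<phi> by simp
    then show ?thesis
      using gcd_of_fibre_ideal[OF \<phi> g p exact \<psi>0 \<psi>_dvd \<psi>_ideal ij(1,2) not_X2 X2_ideal] by blast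
  qed
  \<comment> \<open>The first two factors make each point good, the last makes the two fibres independent in the pencil.\<close>
  define Z where "Z = in_x (B * D) * [:B * D:] * minor a b"
  show ?thesis
  proof (rule for_general_pairsI[OF inf])
    have "in_x (B * D) \<noteq> 0" using B(1) D0 by (metis at_y_0 at_y_in_x mult_eq_0_iff)
    then show "Z \<noteq> 0" using B(1) D0 ab(4) by (simp add: Z_def)
  next
    fix x y
    assume "poly (at_y y Z) x \<noteq> 0"
    then have x: "poly (B * D) x \<noteq> 0" and y: "poly (B * D) y \<noteq> 0" and \<delta>: "poly (cross a b y) x \<noteq> 0"
      by (auto simp: Z_def)
    show "\<forall>f\<^sub>1 f\<^sub>2.
           is_gcd_of_ideal (I1_at (proj_map g (affine_point x)) \<phi>) f\<^sub>1 \<longrightarrow>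
           is_gcd_of_ideal (I1_at (proj_map g (affine_point y)) \<phi>) f\<^sub>2 \<longrightarrow>
           adjoin {h \<in> I. homogeneous d h} \<subseteq> adjoin {f\<^sub>1, f\<^sub>2}"
    proof (intro allI impI)
      fix f\<^sub>1 f\<^sub>2
      assume "is_gcd_of_ideal (I1_at (proj_map g (affine_point x)) \<phi>) f\<^sub>1"
        "is_gcd_of_ideal (I1_at (proj_map g (affine_point y)) \<phi>) f\<^sub>2"
      with gcd[OF x] gcd[OF y] obtain c\<^sub>1 c\<^sub>2 where
        f: "f\<^sub>1 = const2 c\<^sub>1 * \<psi> x" "f\<^sub>2 = const2 c\<^sub>2 * \<psi> y" and c: "c\<^sub>1 \<noteq> 0" "c\<^sub>2 \<noteq> 0" by blast
      define A where "A = adjoin {f\<^sub>1, f\<^sub>2}"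
      have A: "subalgebra A" unfolding A_def by (rule subalgebra_adjoin)
      note A_intros = subalgebra_const[OF A] subalgebra_mult[OF A] subalgebra_diff[OF A]
      have cancel: "t \<in> A" if "const2 c * t \<in> A" "c \<noteq> 0" for c t
      proof -
        have "const2 (inverse c) * (const2 c * t) \<in> A" by (intro A_intros that(1))
        moreover have "const2 (inverse c) * const2 c = 1" using that(2) by (simp add: const2_def one_pCons)
        ultimately show ?thesis by (metis mult.assoc mult.left_neutral)
      qed
      have "f\<^sub>1 \<in> A" "f\<^sub>2 \<in> A" using adjoin_superset[of "{f\<^sub>1, f\<^sub>2}"] by (auto simp: A_def)
      then have \<psi>A: "\<psi> x \<in> A" "\<psi> y \<in> A" using c cancel unfolding f by blast+
      have combine: "homogenize r u \<in> A"
        if "smult (poly u x) (cross a b y) - smult (poly u y) (cross a b x) = smult (poly (cross a b y) x) u" for u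
      proof (rule cancel[OF _ \<delta>])
        have "const2 (poly (cross a b y) x) * homogenize r u
            = const2 (poly u x) * \<psi> y - const2 (poly u y) * \<psi> x"
          using arg_cong[OF that, of "homogenize r"] by (simp add: homogenize_diff homogenize_smult \<psi>_def)
        then show "const2 (poly (cross a b y) x) * homogenize r u \<in> A"
          using \<psi>A by (simp add: A_intros)
      qed
      have ab_A: "homogenize r a \<in> A" "homogenize r b \<in> A"
        by (rule combine, rule pencil_combinations)+
      have "G \<subseteq> A"
      proof
        fix w assume w: "w \<in> G"
        then obtain e where "dehomogenize w = (\<Sum>l\<le>m. smult (e l) (a ^ l * b ^ (m - l)))"
          using expand by blast
        then have "w = homogenize (m * r) (\<Sum>l\<le>m. smult (e l) (a ^ l * b ^ (m - l)))"
          using homogenize_dehomogenize[OF homG[OF w]] dm by (simp add: r_def)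
        then show "w \<in> A"
          using form_in_pencil_in_subalgebra[OF A _ ab_A(1) _ ab_A(2)] ab(1) by (simp add: r_def)
      qed
      then have "{h \<in> I. homogeneous d h} \<subseteq> A"
        using forms_of_ideal_in_subalgebra[OF A homG] by (auto simp: I)
      then show "adjoin {h \<in> I. homogeneous d h} \<subseteq> adjoin {f\<^sub>1, f\<^sub>2}"
        using adjoin_minimal[OF _ A] unfolding A_def by blast
    qed
  qed
qed

end
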